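(* Let $k\ge 0$, $\theta\in\{0,1,-1\}$, $\gamma>0$, let $\zeta=\{\zeta_F\}_{F\in\mathcal F_h}$ be non-negative constants, let $c_h\in\{c_h^1,c_h^2\}$, and let $\boldsymbol X_h\in\{\boldsymbol V_h,\boldsymbol V_h^{\mathrm{div}}\}$. If $\boldsymbol X_h=\boldsymbol V_h$, assume that $\zeta_F\ge\tfrac12|1-\theta|$ for all boundary faces $F\in\mathcal F_h^\partial$; if $\boldsymbol X_h=\boldsymbol V_h^{\mathrm{div}}$, the $\zeta_F\geq 0$ are arbitrary. Let $0=t_0<t_1<\dots<t_N=T$, $\tau_n=t_{n+1}-t_n$, $\boldsymbol u_h^0\in\boldsymbol X_h$, and let $\{(\boldsymbol u_h^{n+1},P_h^{n+\frac12})\}_{n=0}^{N-1}\subset\boldsymbol X_h\times Q_h$ satisfy, for all $0\le n\le N-1$, $$\Big(\tfrac{\boldsymbol u_h^{n+1}-\boldsymbol u_h^n}{\tau_n},\boldsymbol v_h\Big)+c_h\big(\boldsymbol u_h^{n+\frac12};\boldsymbol u_h^{n+\frac12},\boldsymbol v_h\big)-b_h\big(\boldsymbol v_h,P_h^{n+\frac12}\big)+d_h\big(\boldsymbol u_h^{n+\frac12},\boldsymbol v_h\big)=0\quad\forall\boldsymbol v_h\in\boldsymbol X_h,$$ $$b_h\big(\boldsymbol u_h^{n+\frac12},q_h\big)=0\quad\forall q_h\in Q_h,$$ where $\boldsymbol u_h^{n+\frac12}=\tfrac12(\boldsymbol u_h^{n+1}+\boldsymbol u_h^n)$. Then $$\|\boldsymbol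 u_h^{n+1}\|_{L^2(\Omega)}\le\|\boldsymbol u_h^n\|_{L^2(\Omega)}\qquad\text{for }0\le n\le N-1.$$
   Context: **Mesh.** $\mathcal T_h$ is a conforming shape-regular simplicial mesh of a bounded polyhedral domain $\Omega\subset\mathbb R^d$, $d\in\{2,3\}$; $\mathcal F_h$ is its set of faces, $\mathcal F_h^i$ the interior faces, $\mathcal F_h^\partial$ the boundary faces, $h_F$ the diameter of $F$. Each $F\in\mathcal F_h^i$ carries a fixed unit normal $\boldsymbol n_F$ pointing from one adjacent element $K^+$ to the other, $K^-$; for $F\in\mathcal F_h^\partial$, $\boldsymbol n_F$ is the outward unit normal to $\partial\Omega$. $\boldsymbol n|_F:=\boldsymbol n_F$. For a scalar- or vector-valued piecewise smooth $\phi$: on interior faces $[\![\phi]\!]=\phi|_{K^+}-\phi|_{K^-}$ and $\{\!\{\phi\}\!\}=\frac12(\phi|_{K^+}+\phi|_{K^-})$; on a boundary face of $K$, $[\![\phi]\!]=\{\!\{\phi\}\!\}=\phi|_K$. $(\cdot,\cdot)$ is the $L^2(\Omega)$ inner product, $\langle\cdot,\cdot\rangle_F$ the $L^2(F)$ inner product, $\langle\cdot,\cdot\rangle_{\mathcal F_h}=\sum_{F\in\mathcal F_h}\langle\cdot,\cdot\rangle_F$, $\langle\cdot,\cdot\rangle_{\mathcal F_h^i}=\sum_{F\in\mathcal F_h^i}\langle\cdot,\cdot\rangle_F$. $\nabla_h$, $\nabla_h\cdot$ are the elementwise gradient and divergence; $\boldsymbol\beta\cdot\nabla_h\boldsymbol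 v=(\boldsymbol\beta\cdot\nabla_h)\boldsymbol v$, i.e. $(\boldsymbol\beta\cdot\nabla_h\boldsymbol v)_i=\sum_j\beta_j\partial_jv_i$. **Spaces.** With $\mathcal P_j(K)$ the polynomials of degree at most $j$ on $K$: $\boldsymbol V_h=\{\boldsymbol v\in[L^2(\Omega)]^d:\boldsymbol v|_K\in[\mathcal P_{k+1}(K)]^d\ \forall K\in\mathcal T_h\}$; $Q_h=\{q\in L^2(\Omega):\int_\Omega q=0,\ q|_K\in\mathcal P_k(K)\ \forall K\in\mathcal T_h\}$; $\boldsymbol V_h^{\mathrm{div}}=\{\boldsymbol v\in H(\mathrm{div};\Omega):\boldsymbol v|_K\in\boldsymbol{\mathcal Q}_k(K)\ \forall K,\ \boldsymbol v\cdot\boldsymbol n|_{\partial\Omega}=0\}$, where either $\boldsymbol{\mathcal Q}_k(K)=[\mathcal P_k(K)]^d+\mathcal P_k(K)\boldsymbol x$ for all $K$ (Raviart–Thomas) or $\boldsymbol{\mathcal Q}_k(K)=[\mathcal P_{k+1}(K)]^d$ for all $K$ (Brezzi–Douglas–Marini). **Forms.** $$b_h(\boldsymbol v,q)=(\nabla_h\cdot\boldsymbol v,q)-\langle[\![\boldsymbol v]\!]\cdot\boldsymbol n,\{\!\{q\}\!\}\rangle_{\mathcal F_h},$$ $$d_h(\boldsymbol u,\boldsymbol v)=\gamma\Big(\sum_{F\in\mathcal F_h}h_F^{-1}\langle[\![\boldsymbol u]\!]\cdot\boldsymbol n_F,[\![\boldsymbol v]\!]\cdot\boldsymbol n_F\rangle_F+(\nabla_h\cdot\boldsymbol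 u,\nabla_h\cdot\boldsymbol v)\Big),$$ $$\begin{aligned}c_h^1(\boldsymbol u;\boldsymbol u,\boldsymbol v)=&(\boldsymbol u\cdot\nabla_h\boldsymbol u,\boldsymbol v)+\tfrac12((\nabla_h\cdot\boldsymbol u)\boldsymbol u,\boldsymbol v)-\langle(\{\!\{\boldsymbol u\}\!\}\cdot\boldsymbol n)[\![\boldsymbol u]\!],\{\!\{\boldsymbol v\}\!\}\rangle_{\mathcal F_h^i}-\tfrac12\langle[\![\boldsymbol u]\!]\cdot\boldsymbol n,\{\!\{\boldsymbol u\cdot\boldsymbol v\}\!\}\rangle_{\mathcal F_h^i}\\&+\langle\zeta|\{\!\{\boldsymbol u\}\!\}\cdot\boldsymbol n|[\![\boldsymbol u]\!],[\![\boldsymbol v]\!]\rangle_{\mathcal F_h}+\theta\langle(\{\!\{\boldsymbol v\}\!\}\cdot\boldsymbol n)[\![\boldsymbol u]\!],\{\!\{\boldsymbol u\}\!\}\rangle_{\mathcal F_h^i}+\tfrac\theta2\langle[\![\boldsymbol v]\!]\cdot\boldsymbol n,\{\!\{\boldsymbol u\cdot\boldsymbol u\}\!\}\rangle_{\mathcal F_h^i}\\&-\theta(\boldsymbol v\cdot\nabla_h\boldsymbol u,\boldsymbol u)-\tfrac\theta2((\nabla_h\cdot\boldsymbol v)\boldsymbol u,\boldsymbol u),\end{aligned}$$ $$\begin{aligned}c_h^2(\boldsymbol u;\boldsymbol u,\boldsymbol v)=&(\boldsymbol u\cdot\nabla_h\boldsymbol u,\boldsymbol v)+\tfrac{1-\theta}2((\nabla_h\cdot\boldsymbol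 u)\boldsymbol u,\boldsymbol v)-\langle(\{\!\{\boldsymbol u\}\!\}\cdot\boldsymbol n)[\![\boldsymbol u]\!],\{\!\{\boldsymbol v\}\!\}\rangle_{\mathcal F_h^i}-\tfrac{1-\theta}2\langle[\![\boldsymbol u]\!]\cdot\boldsymbol n,\{\!\{\boldsymbol u\cdot\boldsymbol v\}\!\}\rangle_{\mathcal F_h^i}\\&+\langle\zeta|\{\!\{\boldsymbol u\}\!\}\cdot\boldsymbol n|[\![\boldsymbol u]\!],[\![\boldsymbol v]\!]\rangle_{\mathcal F_h}+\theta\langle(\{\!\{\boldsymbol v\}\!\}\cdot\boldsymbol n)[\![\boldsymbol u]\!],\{\!\{\boldsymbol u\}\!\}\rangle_{\mathcal F_h^i}-\theta(\boldsymbol v\cdot\nabla_h\boldsymbol u,\boldsymbol u).\end{aligned}$$ Here $\zeta|_F=\zeta_F$. *)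

theory Defs
  imports "HOL-Analysis.Analysis"
begin

section \<open>Square integrable functions, derivatives, polynomials\<close>

definition L2 :: "(real^'n) set \<Rightarrow> (real^'n \<Rightarrow> 'b::euclidean_space) set" where
  "L2 \<Omega> = {f. f \<in> borel_measurable (lebesgue_on \<Omega>) \<and>
              integrable (lebesgue_on \<Omega>) (\<lambda>x. (norm (f x))\<^sup>2)}"

definition L2_inner :: "(real^'n) set \<Rightarrow> (real^'n \<Rightarrow> 'b::euclidean_space) \<Rightarrow> (real^'n \<Rightarrow> 'b) \<Rightarrow> real" where
  "L2_inner \<Omega> f g = (LINT x|lebesgue_on \<Omega>. f x \<bullet> g x)"

definition L2_norm :: "(real^'n) set \<Rightarrow> (real^'n \<Rightarrow> 'b::euclidean_space) \<Rightarrow> real" where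
  "L2_norm \<Omega> f = sqrt (L2_inner \<Omega> f f)"

definition partial :: "'n::finite \<Rightarrow> (real^'n \<Rightarrow> real) \<Rightarrow> real^'n \<Rightarrow> real" where
  "partial i f x = frechet_derivative f (at x) (axis i 1)"

text \<open>
  The operators below are pointwise. For a function that is smooth on each open element of a mesh,
  its pointwise derivative at a point of an open element is the derivative of its restriction to
  that element, so that they are the elementwise operators; the skeleton of the mesh, where they
  have no meaning, is a null set.
\<close>

definition grad :: "(real^'n \<Rightarrow> real) \<Rightarrow> real^'n \<Rightarrow> real^'n::finite" where
  "grad f x = (\<chi> i. partial i f x)"

definition divg :: "(real^'n \<Rightarrow> real^'n) \<Rightarrow> real^'n::finite \<Rightarrow> real" where
  "divg v x = (\<Sum>i\<in>UNIV. partial i (\<lambda>y. v y $ i) x)"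

definition advect :: "(real^'n \<Rightarrow> real^'n) \<Rightarrow> (real^'n \<Rightarrow> real^'n) \<Rightarrow> real^'n \<Rightarrow> real^'n::finite" where
  "advect \<beta> v x = (\<chi> i. \<Sum>j\<in>UNIV. \<beta> x $ j * partial j (\<lambda>y. v y $ i) x)"

text \<open>Test functions: infinitely differentiable, with compact support inside \<open>\<Omega>\<close>.\<close>

definition test_functions :: "(real^'n) set \<Rightarrow> (real^'n::finite \<Rightarrow> real) set" where
  "test_functions \<Omega> = {\<phi>. (\<forall>is. foldr partial is \<phi> differentiable_on UNIV) \<and>
      compact (closure {x. \<phi> x \<noteq> 0}) \<and> closure {x. \<phi> x \<noteq> 0} \<subseteq> \<Omega>}"

definition H_div :: "(real^'n) set \<Rightarrow> (real^'n \<Rightarrow> real^'n::finite) set" where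
  "H_div \<Omega> = {v \<in> L2 \<Omega>. \<exists>g \<in> L2 \<Omega>. \<forall>\<phi> \<in> test_functions \<Omega>.
      L2_inner \<Omega> v (grad \<phi>) = - L2_inner \<Omega> g \<phi>}"

definition polys :: "nat \<Rightarrow> (real^'n::finite \<Rightarrow> real) set" where
  "polys j = {p. \<exists>c. \<forall>x. p x =
      (\<Sum>\<alpha> | (\<Sum>i\<in>UNIV. \<alpha> i) \<le> j. c \<alpha> * (\<Prod>i\<in>UNIV. (x $ i) ^ \<alpha> i))}"

lemma finite_exponents: "finite {\<alpha>::'n::finite \<Rightarrow> nat. (\<Sum>i\<in>UNIV. \<alpha> i) \<le> j}"
proof (rule finite_subset)
  show "{\<alpha>::'n \<Rightarrow> nat. (\<Sum>i\<in>UNIV. \<alpha> i) \<le> j} \<subseteq> UNIV \<rightarrow>\<^sub>E {..j}"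
  proof
    fix \<alpha> :: "'n \<Rightarrow> nat" assume "\<alpha> \<in> {\<alpha>. (\<Sum>i\<in>UNIV. \<alpha> i) \<le> j}"
    moreover have "\<alpha> i \<le> (\<Sum>i\<in>UNIV. \<alpha> i)" for i by (rule member_le_sum) auto
    ultimately show "\<alpha> \<in> UNIV \<rightarrow>\<^sub>E {..j}" by (auto intro: order_trans)
  qed
qed (auto intro: finite_PiE)

definition vec_polys :: "nat \<Rightarrow> (real^'n \<Rightarrow> real^'n::finite) set" where
  "vec_polys j = {p. \<forall>i. (\<lambda>x. p x $ i) \<in> polys j}"

definition RT :: "nat \<Rightarrow> (real^'n \<Rightarrow> real^'n::finite) set" where
  "RT k = {\<lambda>x. p x + q x *\<^sub>R x | p q. p \<in> vec_polys k \<and> q \<in> polys k}"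

definition BDM :: "nat \<Rightarrow> (real^'n \<Rightarrow> real^'n::finite) set" where
  "BDM k = vec_polys (k + 1)"


section \<open>Meshes\<close>

definition polyhedral_domain :: "'a::euclidean_space set \<Rightarrow> bool" where
  "polyhedral_domain \<Omega> \<longleftrightarrow> \<Omega> \<noteq> {} \<and> open \<Omega> \<and> connected \<Omega> \<and> bounded \<Omega> \<and>
     (\<exists>\<P>. finite \<P> \<and> (\<forall>P\<in>\<P>. polytope P) \<and> \<Omega> = interior (\<Union>\<P>))"

text \<open>
  A mesh comes with its domain, the fixed unit normals of its faces, and the adjacent elements
  \<open>K\<^sup>+\<close> and \<open>K\<^sup>-\<close> of its interior faces. For a boundary face, \<open>Kplus\<close> is the only adjacent element
  and \<open>Kminus\<close> has no meaning.
\<close>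

record 'n mesh =
  region :: "(real^'n) set"
  cells :: "(real^'n) set set"
  normal :: "(real^'n) set \<Rightarrow> real^'n"
  Kplus :: "(real^'n) set \<Rightarrow> (real^'n) set"
  Kminus :: "(real^'n) set \<Rightarrow> (real^'n) set"

definition faces :: "'n::finite mesh \<Rightarrow> (real^'n) set set" where
  "faces M = {F. \<exists>K\<in>cells M. F facet_of K}"

definition interior_faces :: "'n::finite mesh \<Rightarrow> (real^'n) set set" where
  "interior_faces M = {F. \<exists>K\<in>cells M. \<exists>L\<in>cells M. K \<noteq> L \<and> F facet_of K \<and> F facet_of L}"

definition boundary_faces :: "'n::finite mesh \<Rightarrow> (real^'n) set set" where
  "boundary_faces M = {F \<in> faces M. F \<subseteq> frontier (region M)}"

text \<open>\<open>F\<close> is meant to be a facet of the full-dimensional convex set \<open>K\<close>; the inequality at the points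
  \<open>y \<in> F\<close> makes \<open>n\<close> orthogonal to \<open>F\<close>.\<close>

definition outer_unit_normal :: "'a::euclidean_space set \<Rightarrow> 'a set \<Rightarrow> 'a \<Rightarrow> bool" where
  "outer_unit_normal K F n \<longleftrightarrow> norm n = 1 \<and> (\<forall>x\<in>F. \<forall>y\<in>K. n \<bullet> (y - x) \<le> 0)"

text \<open>The outward normal of \<open>\<Omega>\<close> on a boundary face is that of the element adjacent to the face.\<close>

definition conforming_mesh :: "'n::finite mesh \<Rightarrow> bool" where
  "conforming_mesh M \<longleftrightarrow>
     polyhedral_domain (region M) \<and>
     triangulation (cells M) \<and>
     (\<forall>K\<in>cells M. int CARD('n) simplex K) \<and>
     \<Union>(cells M) = closure (region M) \<and>
     (\<forall>F\<in>interior_faces M.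
        Kplus M F \<in> cells M \<and> F facet_of Kplus M F \<and>
        Kminus M F \<in> cells M \<and> F facet_of Kminus M F \<and>
        Kplus M F \<noteq> Kminus M F \<and>
        outer_unit_normal (Kplus M F) F (normal M F)) \<and>
     (\<forall>F\<in>boundary_faces M.
        Kplus M F \<in> cells M \<and> F facet_of Kplus M F \<and>
        outer_unit_normal (Kplus M F) F (normal M F))"

definition shape_regular :: "real \<Rightarrow> 'n::finite mesh \<Rightarrow> bool" where
  "shape_regular \<sigma> M \<longleftrightarrow>
     (\<forall>K\<in>cells M. diameter K \<le> \<sigma> * (SUP r\<in>{r. \<exists>x. cball x r \<subseteq> K}. r))"


section \<open>Traces, jumps, averages and face integrals\<close>

text \<open>\<open>\<phi>|\<^sub>K\<close> at a point of the closed element \<open>K\<close>: the limit from the interior of \<open>K\<close>.\<close>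

definition trace :: "(real^'n::finite) set \<Rightarrow> (real^'n \<Rightarrow> 'b::real_normed_vector) \<Rightarrow> real^'n \<Rightarrow> 'b" where
  "trace K \<phi> x = Lim (at x within interior K) \<phi>"

definition jump :: "'n::finite mesh \<Rightarrow> (real^'n) set \<Rightarrow> (real^'n \<Rightarrow> 'b::real_normed_vector) \<Rightarrow> real^'n \<Rightarrow> 'b" where
  "jump M F \<phi> x = (if F \<in> interior_faces M
     then trace (Kplus M F) \<phi> x - trace (Kminus M F) \<phi> x
     else trace (Kplus M F) \<phi> x)"

definition avg :: "'n::finite mesh \<Rightarrow> (real^'n) set \<Rightarrow> (real^'n \<Rightarrow> 'b::real_normed_vector) \<Rightarrow> real^'n \<Rightarrow> 'b" where
  "avg M F \<phi> x = (if F \<in> interior_faces M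
     then (1/2) *\<^sub>R (trace (Kplus M F) \<phi> x + trace (Kminus M F) \<phi> x)
     else trace (Kplus M F) \<phi> x)"

text \<open>
  Surface measure on a hyperplane \<open>H\<close> of a \<open>d\<close>-dimensional space: the \<open>(d-1)\<close>-dimensional measure of
  \<open>A \<subseteq> H\<close> is the \<open>d\<close>-dimensional Lebesgue measure of the prism of height 1 over \<open>A\<close>, that is, of the
  points at distance at most \<open>1/2\<close> from \<open>H\<close> whose orthogonal projection onto \<open>H\<close> lies in \<open>A\<close>.
\<close>

definition surface_measure :: "'a::euclidean_space set \<Rightarrow> 'a measure" where
  "surface_measure H =
     distr (restrict_space lborel {x. infdist x H \<le> 1/2}) borel (closest_point H)"

definition face_inner :: "(real^'n::finite) set \<Rightarrow> (real^'n \<Rightarrow> 'b::euclidean_space) \<Rightarrow> (real^'n \<Rightarrow> 'b) \<Rightarrow> real" where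
  "face_inner F f g = (LINT x:F|surface_measure (affine hull F). f x \<bullet> g x)"


section \<open>Discrete spaces\<close>

text \<open>
  Elements of \<open>L\<^sup>2(\<Omega>)\<close> are represented by functions; a class of piecewise polynomials is represented
  by the functions that are equal to the polynomials everywhere on the open elements. The values on
  the skeleton of the mesh and outside \<open>\<Omega>\<close> are irrelevant.
\<close>

definition piecewise :: "'n::finite mesh \<Rightarrow> (real^'n \<Rightarrow> 'b) set \<Rightarrow> (real^'n \<Rightarrow> 'b) set" where
  "piecewise M S = {v. \<forall>K\<in>cells M. \<exists>p\<in>S. \<forall>x\<in>interior K. v x = p x}"

definition V_h :: "'n::finite mesh \<Rightarrow> nat \<Rightarrow> (real^'n \<Rightarrow> real^'n) set" where
  "V_h M k = L2 (region M) \<inter> piecewise M (vec_polys (k + 1))"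

definition Q_h :: "'n::finite mesh \<Rightarrow> nat \<Rightarrow> (real^'n \<Rightarrow> real) set" where
  "Q_h M k = {q \<in> L2 (region M) \<inter> piecewise M (polys k). (LINT x|lebesgue_on (region M). q x) = 0}"

text \<open>\<open>S\<close> is the local space, \<open>RT k\<close> or \<open>BDM k\<close>.\<close>

definition V_div :: "'n::finite mesh \<Rightarrow> (real^'n \<Rightarrow> real^'n) set \<Rightarrow> (real^'n \<Rightarrow> real^'n) set" where
  "V_div M S = {v \<in> H_div (region M) \<inter> piecewise M S.
     \<forall>F\<in>boundary_faces M. \<forall>x\<in>F. trace (Kplus M F) v x \<bullet> normal M F = 0}"


section \<open>Forms\<close>

definition b_form :: "'n::finite mesh \<Rightarrow> (real^'n \<Rightarrow> real^'n) \<Rightarrow> (real^'n \<Rightarrow> real) \<Rightarrow> real" where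
  "b_form M v q = L2_inner (region M) (divg v) q
     - (\<Sum>F\<in>faces M. face_inner F (\<lambda>x. jump M F v x \<bullet> normal M F) (avg M F q))"

definition d_form :: "'n::finite mesh \<Rightarrow> real \<Rightarrow> (real^'n \<Rightarrow> real^'n) \<Rightarrow> (real^'n \<Rightarrow> real^'n) \<Rightarrow> real" where
  "d_form M \<gamma> u v = \<gamma> *
     ((\<Sum>F\<in>faces M. 1 / diameter F *
         face_inner F (\<lambda>x. jump M F u x \<bullet> normal M F) (\<lambda>x. jump M F v x \<bullet> normal M F))
      + L2_inner (region M) (divg u) (divg v))"

text \<open>\<open>c1_form M \<zeta> \<theta> u v\<close> and \<open>c2_form M \<zeta> \<theta> u v\<close> stand for \<open>c\<^sub>h\<^sup>1(u; u, v)\<close> and \<open>c\<^sub>h\<^sup>2(u; u, v)\<close>.\<close>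

definition c1_form :: "'n::finite mesh \<Rightarrow> ((real^'n) set \<Rightarrow> real) \<Rightarrow> real
    \<Rightarrow> (real^'n \<Rightarrow> real^'n) \<Rightarrow> (real^'n \<Rightarrow> real^'n) \<Rightarrow> real" where
  "c1_form M \<zeta> \<theta> u v =
     L2_inner (region M) (advect u u) v
     + 1/2 * L2_inner (region M) (\<lambda>x. divg u x *\<^sub>R u x) v
     - (\<Sum>F\<in>interior_faces M.
          face_inner F (\<lambda>x. (avg M F u x \<bullet> normal M F) *\<^sub>R jump M F u x) (avg M F v))
     - 1/2 * (\<Sum>F\<in>interior_faces M.
          face_inner F (\<lambda>x. jump M F u x \<bullet> normal M F) (avg M F (\<lambda>x. u x \<bullet> v x)))
     + (\<Sum>F\<in>faces M.
          face_inner F (\<lambda>x. (\<zeta> F * \<bar>avg M F u x \<bullet> normal M F\<bar>) *\<^sub>R jump M F u x) (jump M F v))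
     + \<theta> * (\<Sum>F\<in>interior_faces M.
          face_inner F (\<lambda>x. (avg M F v x \<bullet> normal M F) *\<^sub>R jump M F u x) (avg M F u))
     + \<theta>/2 * (\<Sum>F\<in>interior_faces M.
          face_inner F (\<lambda>x. jump M F v x \<bullet> normal M F) (avg M F (\<lambda>x. u x \<bullet> u x)))
     - \<theta> * L2_inner (region M) (advect v u) u
     - \<theta>/2 * L2_inner (region M) (\<lambda>x. divg v x *\<^sub>R u x) u"

definition c2_form :: "'n::finite mesh \<Rightarrow> ((real^'n) set \<Rightarrow> real) \<Rightarrow> real
    \<Rightarrow> (real^'n \<Rightarrow> real^'n) \<Rightarrow> (real^'n \<Rightarrow> real^'n) \<Rightarrow> real" where
  "c2_form M \<zeta> \<theta> u v =
     L2_inner (region M) (advect u u) v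
     + (1 - \<theta>)/2 * L2_inner (region M) (\<lambda>x. divg u x *\<^sub>R u x) v
     - (\<Sum>F\<in>interior_faces M.
          face_inner F (\<lambda>x. (avg M F u x \<bullet> normal M F) *\<^sub>R jump M F u x) (avg M F v))
     - (1 - \<theta>)/2 * (\<Sum>F\<in>interior_faces M.
          face_inner F (\<lambda>x. jump M F u x \<bullet> normal M F) (avg M F (\<lambda>x. u x \<bullet> v x)))
     + (\<Sum>F\<in>faces M.
          face_inner F (\<lambda>x. (\<zeta> F * \<bar>avg M F u x \<bullet> normal M F\<bar>) *\<^sub>R jump M F u x) (jump M F v))
     + \<theta> * (\<Sum>F\<in>interior_faces M.
          face_inner F (\<lambda>x. (avg M F v x \<bullet> normal M F) *\<^sub>R jump M F u x) (avg M F u))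
     - \<theta> * L2_inner (region M) (advect v u) u"

end

theory Submission
  imports Defs
begin

text \<open>
  The midpoint velocity \<open>w = u_half n\<close> lies in \<open>X_h\<close>, because every discrete space is closed under
  midpoints, and it may serve as the test function. The time difference then becomes
  \<open>(\<parallel>u (n+1)\<parallel>\<^sup>2 - \<parallel>u n\<parallel>\<^sup>2) / (2 \<tau>)\<close>, the pressure term vanishes by the discrete
  incompressibility, and the stabilisation \<open>d_form\<close> is a nonnegative quadratic form. All that remains
  is to see that the convective form is nonnegative at \<open>(w, w)\<close> (\<open>convection_nonneg\<close>).

  On the diagonal each term of \<open>c_h\<close> with a factor \<open>\<theta>\<close> repeats a term without it, so both forms equal
  \<open>1 - \<theta>\<close> times a common expression plus the upwind penalty. The volume part of this expression
  integrates \<open>(1/2) div (\<bar>w\<bar>\<^sup>2 w)\<close> over each element. By the divergence theorem it is a sum of fluxes through facets;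
  the two fluxes through an interior face combine, by the product rule for jumps and averages, into
  exactly the interior face terms, which cancel it (\<open>convection_energy_balance\<close>). What is left is
  half the flux of \<open>\<bar>w\<bar>\<^sup>2 w\<close> through the boundary faces. It vanishes if \<open>w \<bullet> n = 0\<close> there, and
  otherwise the penalty dominates it because \<open>\<zeta> \<ge> \<bar>1 - \<theta>\<bar> / 2\<close>. The cancellation at interior faces holds
  for arbitrary jumps, so the divergence-conforming spaces and the discontinuous one are treated alike.

  The divergence theorem is proved for simplices and for the prism definition of the surface
  measure. For \<open>m \<bullet> e = 1\<close> the integral of \<open>f\<close> is the integral over the slab \<open>\<bar>m \<bullet> x\<bar> \<le> 1/2\<close> of the line
  integrals of \<open>f\<close> in the direction \<open>e\<close>, by Fubini and translation invariance
  (\<open>integral_along_lines\<close>). In the same way an integral over a slab of a function of the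
  oblique projection of \<open>x\<close> onto a hyperplane is a multiple of the surface integral
  (\<open>integral_oblique\<close>). If \<open>e\<close> is an edge \<open>a - b\<close> of a simplex, then a line in direction \<open>e\<close> enters
  through the facet opposite to \<open>a\<close>, leaves through the facet opposite to \<open>b\<close>, and is parallel to
  the other facets, so that the fundamental theorem of calculus along these lines is the divergence
  theorem in the direction \<open>e\<close>. The edges at one vertex span the space, and the statement is linear
  in the direction (\<open>divergence_theorem_simplex\<close>).

  The geometry of the mesh enters through two facts: distinct elements with a common facet lie
  on opposite sides of it, so that there are at most two of them (\<open>mesh_opposite_normal\<close>,
  \<open>mesh_at_most_two_cells\<close>), and a facet of one element only lies on the boundary of the domain
  (\<open>mesh_face_boundary\<close>).
\<close>

section \<open>Integration along parallel lines\<close>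

text \<open>
  The width 1 and the closed ends are those of the prism that defines the surface measure.
\<close>

definition unit_slab :: "real set" where "unit_slab = {-1/2..1/2}"

lemma unit_slab_sets [measurable]: "unit_slab \<in> sets borel"
  by (simp add: unit_slab_def)

lemma emeasure_unit_slab [simp]: "emeasure lborel unit_slab = 1"
  by (simp add: unit_slab_def)

lemma nn_integral_lborel_shift:
  fixes f :: "'a::euclidean_space \<Rightarrow> ennreal"
  assumes [measurable]: "f \<in> borel_measurable borel"
  shows "(\<integral>\<^sup>+x. f (x + a) \<partial>lborel) = (\<integral>\<^sup>+x. f x \<partial>lborel)"
proof -
  have "(\<integral>\<^sup>+x. f x \<partial>lborel) = (\<integral>\<^sup>+x. f x \<partial>(distr lborel borel ((+) a)))"
    by (simp add: lborel_distr_plus)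
  also have "\<dots> = (\<integral>\<^sup>+x. f (a + x) \<partial>lborel)"
    by (subst nn_integral_distr) auto
  finally show ?thesis by (simp add: add.commute)
qed

text \<open>
  Fubini for the foliation of the space by the lines in direction \<open>e\<close>, with a slab of width 1 in place
  of a transversal hyperplane. Every level \<open>m \<bullet> x + c\<close> is the centre of an interval of length 1, so
  inserting the factor \<open>\<integral> indicator (m \<bullet> x + c - t) dt = 1\<close> changes nothing; after exchanging the
  integrals, the translation by \<open>t e\<close> removes \<open>t\<close> from the indicator and moves it into \<open>f\<close>.
\<close>

lemma nn_integral_along_lines:
  fixes m e :: "'a::euclidean_space" and f :: "'a \<Rightarrow> ennreal"
  assumes [measurable]: "f \<in> borel_measurable borel" and me: "m \<bullet> e = 1"
  shows "(\<integral>\<^sup>+x. f x \<partial>lborel)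
       = (\<integral>\<^sup>+x. indicator unit_slab (m \<bullet> x + c) * (\<integral>\<^sup>+t. f (x + t *\<^sub>R e) \<partial>lborel) \<partial>lborel)"
proof -
  have one: "(\<integral>\<^sup>+t. indicator unit_slab (r - t) \<partial>lborel) = (1::ennreal)" for r :: real
  proof -
    have "(\<integral>\<^sup>+t. indicator unit_slab (r - t) \<partial>lborel) = (\<integral>\<^sup>+t. indicator {r-1/2..r+1/2} t \<partial>lborel)"
      by (intro nn_integral_cong) (auto simp: indicator_def unit_slab_def)
    then show ?thesis by simp
  qed
  have "(\<integral>\<^sup>+x. f x \<partial>lborel)
      = (\<integral>\<^sup>+x. (\<integral>\<^sup>+t. f x * indicator unit_slab (m \<bullet> x + c - t) \<partial>lborel) \<partial>lborel)"
    by (simp add: nn_integral_cmult one)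
  also have "\<dots> = (\<integral>\<^sup>+t. (\<integral>\<^sup>+x. f x * indicator unit_slab (m \<bullet> x + c - t) \<partial>lborel) \<partial>lborel)"
    by (rule lborel_pair.Fubini') measurable
  also have "\<dots> = (\<integral>\<^sup>+t. (\<integral>\<^sup>+x. f (x + t *\<^sub>R e) * indicator unit_slab (m \<bullet> x + c) \<partial>lborel) \<partial>lborel)"
    (is "_ = (\<integral>\<^sup>+t. ?R t \<partial>lborel)")
  proof (rule nn_integral_cong)
    fix t :: real
    have "(\<integral>\<^sup>+x. f x * indicator unit_slab (m \<bullet> x + c - t) \<partial>lborel)
        = (\<integral>\<^sup>+x. f (x + t *\<^sub>R e) * indicator unit_slab (m \<bullet> (x + t *\<^sub>R e) + c - t) \<partial>lborel)"
      by (rule nn_integral_lborel_shift[symmetric]) measurable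
    then show "(\<integral>\<^sup>+x. f x * indicator unit_slab (m \<bullet> x + c - t) \<partial>lborel) = ?R t"
      by (simp add: inner_add_right me)
  qed
  also have "\<dots> = (\<integral>\<^sup>+x. (\<integral>\<^sup>+t. f (x + t *\<^sub>R e) * indicator unit_slab (m \<bullet> x + c) \<partial>lborel) \<partial>lborel)"
    by (rule lborel_pair.Fubini') measurable
  also have "\<dots> = (\<integral>\<^sup>+x. indicator unit_slab (m \<bullet> x + c) * (\<integral>\<^sup>+t. f (x + t *\<^sub>R e) \<partial>lborel) \<partial>lborel)"
    by (simp add: nn_integral_multc mult.commute)
  finally show ?thesis .
qed

text \<open>
  The positive and the negative part are both covered by \<open>nn_integral_along_lines\<close>, which also gives the
  integrability on the product space that Fubini needs.
\<close>

lemma integral_along_lines: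
  fixes m e :: "'a::euclidean_space" and f :: "'a \<Rightarrow> real"
  assumes f: "integrable lborel f" and me: "m \<bullet> e = 1"
  shows "(LINT x|lborel. f x)
       = (LINT x|lborel. indicator unit_slab (m \<bullet> x + c) * (LINT t|lborel. f (x + t *\<^sub>R e)))"
proof -
  have [measurable]: "f \<in> borel_measurable borel"
    using borel_measurable_integrable[OF f] by simp
  define H where "H = (\<lambda>(x, t::real). indicator unit_slab (m \<bullet> x + c) * f (x + t *\<^sub>R e))"
  have [measurable]: "H \<in> borel_measurable (lborel \<Otimes>\<^sub>M lborel)"
    unfolding H_def by measurable
  have nn: "(\<integral>\<^sup>+z. ennreal (g (H z)) \<partial>(lborel \<Otimes>\<^sub>M lborel)) = (\<integral>\<^sup>+x. ennreal (g (f x)) \<partial>lborel)"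
    if [measurable]: "g \<in> borel_measurable borel" and g0: "g 0 = 0" for g :: "real \<Rightarrow> real"
  proof -
    have "(\<integral>\<^sup>+z. ennreal (g (H z)) \<partial>(lborel \<Otimes>\<^sub>M lborel))
        = (\<integral>\<^sup>+x. (\<integral>\<^sup>+t. ennreal (g (H (x, t))) \<partial>lborel) \<partial>lborel)"
      by (rule lborel.nn_integral_fst[symmetric]) measurable
    also have "\<dots> = (\<integral>\<^sup>+x. indicator unit_slab (m \<bullet> x + c)
        * (\<integral>\<^sup>+t. ennreal (g (f (x + t *\<^sub>R e))) \<partial>lborel) \<partial>lborel)"
      by (intro nn_integral_cong) (auto simp: H_def indicator_def g0)
    also have "\<dots> = (\<integral>\<^sup>+x. ennreal (g (f x)) \<partial>lborel)"
      by (rule nn_integral_along_lines[OF _ me, symmetric]) measurable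
    finally show ?thesis .
  qed
  have H: "integrable (lborel \<Otimes>\<^sub>M lborel) H"
    using f nn[of norm] by (simp add: integrable_iff_bounded)
  have "(LINT x|lborel. f x) = (LINT z|(lborel \<Otimes>\<^sub>M lborel). H z)"
    using nn[of "\<lambda>x. x"] nn[of uminus] by (simp add: real_lebesgue_integral_def f H)
  also have "\<dots> = (LINT x|lborel. (LINT t|lborel. H (x, t)))"
    by (rule lborel_pair.integral_fst'[OF H, symmetric])
  finally show ?thesis by (simp add: H_def)
qed

text \<open>
  A function \<open>\<Phi>\<close> that is constant along \<open>e\<close> is integrated over a transversal, and neither the choice
  of the transversal nor the weight \<open>k\<close> put on it matters beyond the total weight: along a line
  in direction \<open>e\<close> the weight integrates to the same constant.
\<close>

lemma nn_integral_transversal: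
  fixes m m' e :: "'a::euclidean_space" and \<Phi> :: "'a \<Rightarrow> ennreal" and k :: "real \<Rightarrow> ennreal"
  assumes [measurable]: "\<Phi> \<in> borel_measurable borel" "k \<in> borel_measurable borel"
    and m: "m \<bullet> e = 1" "m' \<bullet> e = 1"
    and inv: "\<And>x t. \<Phi> (x + t *\<^sub>R e) = \<Phi> x"
  shows "(\<integral>\<^sup>+x. k (m' \<bullet> x) * \<Phi> x \<partial>lborel)
       = (\<integral>\<^sup>+t. k t \<partial>lborel) * (\<integral>\<^sup>+x. indicator unit_slab (m \<bullet> x + c) * \<Phi> x \<partial>lborel)"
proof -
  have "(\<integral>\<^sup>+t. k (m' \<bullet> x + t) * \<Phi> x \<partial>lborel) = (\<integral>\<^sup>+t. k t \<partial>lborel) * \<Phi> x" for x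
    using nn_integral_lborel_shift[of k "m' \<bullet> x"] by (simp add: nn_integral_multc add.commute)
  then show ?thesis
    by (subst nn_integral_along_lines[OF _ m(1), of _ c])
       (simp_all add: inner_add_right m inv mult.left_commute nn_integral_cmult)
qed

text \<open>
  Projecting onto the hyperplane \<open>n \<bullet> x = c\<close> along \<open>e\<close> instead of along \<open>n\<close> shifts the image, at height
  \<open>t\<close> above the hyperplane, by \<open>t (n - e)\<close>, which is parallel to the hyperplane. Layer by layer this is a
  translation, and the integral does not see it.
\<close>

lemma nn_integral_shear:
  fixes n e :: "'a::euclidean_space" and \<psi> :: "'a \<Rightarrow> ennreal"
  assumes [measurable]: "\<psi> \<in> borel_measurable borel"
    and n: "n \<bullet> n = 1" "n \<bullet> e = 1"
  shows "(\<integral>\<^sup>+x. indicator unit_slab (n \<bullet> x - c) * \<psi> (x - (n \<bullet> x - c) *\<^sub>R e) \<partial>lborel)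
       = (\<integral>\<^sup>+x. indicator unit_slab (n \<bullet> x - c) * \<psi> (x - (n \<bullet> x - c) *\<^sub>R n) \<partial>lborel)"
proof -
  define p where "p x = x - (n \<bullet> x - c) *\<^sub>R n" for x
  define f where "f = n - e"
  have nf: "n \<bullet> f = 0" by (simp add: f_def inner_diff_right n)
  have [measurable]: "p \<in> borel_measurable borel" unfolding p_def by measurable
  (* On the line through \<open>x\<close> in direction \<open>n\<close> the projection along \<open>e\<close> moves with velocity \<open>f\<close>. *)
  have line: "x + t *\<^sub>R n - (n \<bullet> (x + t *\<^sub>R n) - c) *\<^sub>R e = p x + ((n \<bullet> x - c) + t) *\<^sub>R f" for x t
    by (simp add: p_def f_def inner_add_right n algebra_simps)
  have "(\<integral>\<^sup>+x. indicator unit_slab (n \<bullet> x - c) * \<psi> (x - (n \<bullet> x - c) *\<^sub>R e) \<partial>lborel)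
      = (\<integral>\<^sup>+x. indicator unit_slab (n \<bullet> x - c)
          * (\<integral>\<^sup>+t. indicator unit_slab ((n \<bullet> x - c) + t) * \<psi> (p x + ((n \<bullet> x - c) + t) *\<^sub>R f) \<partial>lborel) \<partial>lborel)"
  proof (subst nn_integral_along_lines[OF _ n(1), of _ "-c"], measurable, rule nn_integral_cong)
    fix x
    have "(\<integral>\<^sup>+t. indicator unit_slab (n \<bullet> (x + t *\<^sub>R n) - c)
            * \<psi> (x + t *\<^sub>R n - (n \<bullet> (x + t *\<^sub>R n) - c) *\<^sub>R e) \<partial>lborel)
        = (\<integral>\<^sup>+t. indicator unit_slab ((n \<bullet> x - c) + t) * \<psi> (p x + ((n \<bullet> x - c) + t) *\<^sub>R f) \<partial>lborel)"
      unfolding line by (simp add: inner_add_right n algebra_simps)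
    then show "indicator unit_slab (n \<bullet> x + - c) * (\<integral>\<^sup>+t. indicator unit_slab (n \<bullet> (x + t *\<^sub>R n) - c)
            * \<psi> (x + t *\<^sub>R n - (n \<bullet> (x + t *\<^sub>R n) - c) *\<^sub>R e) \<partial>lborel)
        = indicator unit_slab (n \<bullet> x - c)
          * (\<integral>\<^sup>+t. indicator unit_slab ((n \<bullet> x - c) + t) * \<psi> (p x + ((n \<bullet> x - c) + t) *\<^sub>R f) \<partial>lborel)"
      by simp
  qed
  also have "\<dots> = (\<integral>\<^sup>+x. indicator unit_slab (n \<bullet> x - c)
          * (\<integral>\<^sup>+t. indicator unit_slab t * \<psi> (p x + t *\<^sub>R f) \<partial>lborel) \<partial>lborel)"
  proof (rule nn_integral_cong)
    fix x
    show "indicator unit_slab (n \<bullet> x - c)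
          * (\<integral>\<^sup>+t. indicator unit_slab ((n \<bullet> x - c) + t) * \<psi> (p x + ((n \<bullet> x - c) + t) *\<^sub>R f) \<partial>lborel)
        = indicator unit_slab (n \<bullet> x - c)
          * (\<integral>\<^sup>+t. indicator unit_slab t * \<psi> (p x + t *\<^sub>R f) \<partial>lborel)"
      using nn_integral_lborel_shift[of "\<lambda>t. indicator unit_slab t * \<psi> (p x + t *\<^sub>R f)" "n \<bullet> x - c"]
      by (simp add: add.commute)
  qed
  also have "\<dots> = (\<integral>\<^sup>+x. (\<integral>\<^sup>+t. indicator unit_slab (n \<bullet> x - c)
          * (indicator unit_slab t * \<psi> (p x + t *\<^sub>R f)) \<partial>lborel) \<partial>lborel)"
    by (simp add: nn_integral_cmult)
  also have "\<dots> = (\<integral>\<^sup>+t. (\<integral>\<^sup>+x. indicator unit_slab (n \<bullet> x - c)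
          * (indicator unit_slab t * \<psi> (p x + t *\<^sub>R f)) \<partial>lborel) \<partial>lborel)"
    by (rule lborel_pair.Fubini') measurable
  also have "\<dots> = (\<integral>\<^sup>+t. indicator unit_slab t *
        (\<integral>\<^sup>+x. indicator unit_slab (n \<bullet> x - c) * \<psi> (p x) \<partial>lborel) \<partial>lborel)"
  proof (rule nn_integral_cong)
    fix t :: real
    have "(\<integral>\<^sup>+x. indicator unit_slab (n \<bullet> x - c) * \<psi> (p x) \<partial>lborel)
        = (\<integral>\<^sup>+x. indicator unit_slab (n \<bullet> (x + t *\<^sub>R f) - c) * \<psi> (p (x + t *\<^sub>R f)) \<partial>lborel)"
      by (rule nn_integral_lborel_shift[symmetric]) measurable
    also have "\<dots> = (\<integral>\<^sup>+x. indicator unit_slab (n \<bullet> x - c) * \<psi> (p x + t *\<^sub>R f) \<partial>lborel)"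
      by (simp add: inner_add_right nf p_def algebra_simps)
    finally show "(\<integral>\<^sup>+x. indicator unit_slab (n \<bullet> x - c)
          * (indicator unit_slab t * \<psi> (p x + t *\<^sub>R f)) \<partial>lborel)
        = indicator unit_slab t * (\<integral>\<^sup>+x. indicator unit_slab (n \<bullet> x - c) * \<psi> (p x) \<partial>lborel)"
      by (simp add: mult.left_commute nn_integral_cmult)
  qed
  also have "\<dots> = (\<integral>\<^sup>+x. indicator unit_slab (n \<bullet> x - c) * \<psi> (p x) \<partial>lborel)"
    by (simp add: nn_integral_multc)
  finally show ?thesis by (simp add: p_def)
qed

text \<open>
  From each line in direction \<open>v\<close> the slab of \<open>m\<close> cuts out a segment whose height above the hyperplane
  varies by \<open>\<bar>n \<bullet> v\<bar>\<close>, in place of 1. After rescaling \<open>v\<close> to \<open>e\<close> with \<open>n \<bullet> e = 1\<close>, the indicator of this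
  slab is a weight of total mass \<open>\<bar>n \<bullet> v\<bar>\<close>.
\<close>

lemma nn_integral_oblique:
  fixes n v m :: "'a::euclidean_space" and \<psi> :: "'a \<Rightarrow> ennreal"
  assumes [measurable]: "\<psi> \<in> borel_measurable borel"
    and n: "n \<bullet> n = 1" "n \<bullet> v \<noteq> 0" and m: "m \<bullet> v = 1"
  shows "(\<integral>\<^sup>+x. indicator unit_slab (m \<bullet> x) * \<psi> (x - ((n \<bullet> x - c) / (n \<bullet> v)) *\<^sub>R v) \<partial>lborel)
       = ennreal \<bar>n \<bullet> v\<bar> * (\<integral>\<^sup>+x. indicator unit_slab (n \<bullet> x - c) * \<psi> (x - (n \<bullet> x - c) *\<^sub>R n) \<partial>lborel)"
proof -
  define \<alpha> where "\<alpha> = n \<bullet> v"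
  (* With \<open>n \<bullet> e = 1\<close> the shear lemma applies; the projection along \<open>e\<close> is that along \<open>v\<close>. *)
  define e where "e = v /\<^sub>R \<alpha>"
  have \<alpha>: "\<alpha> \<noteq> 0" using n by (simp add: \<alpha>_def)
  have ne: "n \<bullet> e = 1" and me: "(\<alpha> *\<^sub>R m) \<bullet> e = 1"
    using \<alpha> m by (simp_all add: e_def \<alpha>_def)
  have k: "(\<integral>\<^sup>+t. indicator unit_slab (t / \<alpha>) \<partial>lborel) = ennreal \<bar>\<alpha>\<bar>"
  proof -
    have "(\<integral>\<^sup>+t. indicator unit_slab (t / \<alpha>) \<partial>lborel)
        = (\<integral>\<^sup>+t. indicator {-\<bar>\<alpha>\<bar>/2..\<bar>\<alpha>\<bar>/2} t \<partial>lborel)"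
      using \<alpha> by (intro nn_integral_cong) (auto simp: indicator_def unit_slab_def field_simps abs_if split: if_splits)
    then show ?thesis by simp
  qed
  have slab: "((\<alpha> *\<^sub>R m) \<bullet> x) / \<alpha> = m \<bullet> x" for x
    using \<alpha> by simp
  have proj: "((n \<bullet> x - c) / (n \<bullet> v)) *\<^sub>R v = (n \<bullet> x - c) *\<^sub>R e" for x
    by (simp add: e_def \<alpha>_def divide_inverse)
  have "(\<integral>\<^sup>+x. indicator unit_slab (((\<alpha> *\<^sub>R m) \<bullet> x) / \<alpha>) * \<psi> (x - (n \<bullet> x - c) *\<^sub>R e) \<partial>lborel)
      = (\<integral>\<^sup>+t. indicator unit_slab (t / \<alpha>) \<partial>lborel)
         * (\<integral>\<^sup>+x. indicator unit_slab (n \<bullet> x + - c) * \<psi> (x - (n \<bullet> x - c) *\<^sub>R e) \<partial>lborel)"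
    by (rule nn_integral_transversal[OF _ _ ne me]) (auto simp: inner_add_right ne algebra_simps)
  also have "(\<integral>\<^sup>+x. indicator unit_slab (n \<bullet> x + - c) * \<psi> (x - (n \<bullet> x - c) *\<^sub>R e) \<partial>lborel)
      = (\<integral>\<^sup>+x. indicator unit_slab (n \<bullet> x - c) * \<psi> (x - (n \<bullet> x - c) *\<^sub>R n) \<partial>lborel)"
    using nn_integral_shear[OF _ n(1) ne, of \<psi> c] by simp
  finally show ?thesis unfolding slab proj k by (simp add: \<alpha>_def)
qed

lemma integral_oblique:
  fixes n v m :: "'a::euclidean_space" and \<psi> :: "'a \<Rightarrow> real"
  assumes [measurable]: "\<psi> \<in> borel_measurable borel"
    and n: "n \<bullet> n = 1" "n \<bullet> v \<noteq> 0" and m: "m \<bullet> v = 1"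
    and int: "integrable lborel (\<lambda>x. indicator unit_slab (n \<bullet> x - c) * \<psi> (x - (n \<bullet> x - c) *\<^sub>R n))"
  shows "integrable lborel (\<lambda>x. indicator unit_slab (m \<bullet> x) * \<psi> (x - ((n \<bullet> x - c) / (n \<bullet> v)) *\<^sub>R v))" (is ?I)
    and "(LINT x|lborel. indicator unit_slab (m \<bullet> x) * \<psi> (x - ((n \<bullet> x - c) / (n \<bullet> v)) *\<^sub>R v))
       = \<bar>n \<bullet> v\<bar> * (LINT x|lborel. indicator unit_slab (n \<bullet> x - c) * \<psi> (x - (n \<bullet> x - c) *\<^sub>R n))"
proof -
  let ?L = "\<lambda>x. indicator unit_slab (m \<bullet> x) * \<psi> (x - ((n \<bullet> x - c) / (n \<bullet> v)) *\<^sub>R v)"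
  let ?R = "\<lambda>x. indicator unit_slab (n \<bullet> x - c) * \<psi> (x - (n \<bullet> x - c) *\<^sub>R n)"
  have nn: "(\<integral>\<^sup>+x. ennreal (g (?L x)) \<partial>lborel) = ennreal \<bar>n \<bullet> v\<bar> * (\<integral>\<^sup>+x. ennreal (g (?R x)) \<partial>lborel)"
    if [measurable]: "g \<in> borel_measurable borel" and g0: "g 0 = 0" for g :: "real \<Rightarrow> real"
  proof -
    have *: "ennreal (g (indicator A y * z)) = indicator A y * ennreal (g z)" for A and y z :: real
      by (simp add: indicator_def g0)
    show ?thesis unfolding * by (rule nn_integral_oblique[OF _ n m]) measurable
  qed
  show I: ?I
    using int nn[of norm] by (auto simp: integrable_iff_bounded ennreal_mult_less_top)
  show "(LINT x|lborel. ?L x) = \<bar>n \<bullet> v\<bar> * (LINT x|lborel. ?R x)"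
    using nn[of "\<lambda>x. x"] nn[of uminus]
    by (simp add: real_lebesgue_integral_def I int enn2real_mult right_diff_distrib)
qed

section \<open>Surface integrals over facets\<close>

lemma closest_point_hyperplane:
  fixes n :: "'a::euclidean_space"
  assumes n: "norm n = 1"
  shows "closest_point {x. n \<bullet> x = c} x = x - (n \<bullet> x - c) *\<^sub>R n" (is "_ = ?p")
    and "infdist x {x. n \<bullet> x = c} = \<bar>n \<bullet> x - c\<bar>"
proof -
  let ?H = "{x. n \<bullet> x = c}"
  have nn: "n \<bullet> n = 1" using n by (simp add: norm_eq_1)
  have p: "?p \<in> ?H" by (simp add: inner_diff_right nn)
  have d: "dist x ?p = \<bar>n \<bullet> x - c\<bar>" by (simp add: dist_norm n)
  have le: "\<bar>n \<bullet> x - c\<bar> \<le> dist x z" if "z \<in> ?H" for z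
    using Cauchy_Schwarz_ineq2[of n "x - z"] that by (simp add: inner_diff_right n dist_norm)
  show cp: "closest_point ?H x = ?p"
    by (rule closest_point_unique[symmetric])
       (use p le d in \<open>auto simp: convex_hyperplane closed_hyperplane\<close>)
  have ne: "?H \<noteq> {}" using p by blast
  have "infdist x ?H = setdist {x} ?H" by (rule infdist_eq_setdist)
  also have "\<dots> = \<bar>n \<bullet> x - c\<bar>"
    using setdist_closest_point[OF closed_hyperplane ne, of x] d by (simp only: cp)
  finally show "infdist x ?H = \<bar>n \<bullet> x - c\<bar>" .
qed

text \<open>
  The surface measure as a prism integral in explicit coordinates, the form in which
  \<open>integral_oblique\<close> applies to it.
\<close>

lemma surface_measure_hyperplane:
  fixes n :: "'a::euclidean_space" and f :: "'a \<Rightarrow> real"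
  assumes n: "norm n = 1" and [measurable]: "f \<in> borel_measurable borel"
  shows "(LINT x|surface_measure {x. n \<bullet> x = c}. f x)
       = (LINT x|lborel. indicator unit_slab (n \<bullet> x - c) * f (x - (n \<bullet> x - c) *\<^sub>R n))"
    and "integrable (surface_measure {x. n \<bullet> x = c}) f
       \<longleftrightarrow> integrable lborel (\<lambda>x. indicator unit_slab (n \<bullet> x - c) * f (x - (n \<bullet> x - c) *\<^sub>R n))"
proof -
  have [measurable]: "{x. \<bar>n \<bullet> x - c\<bar> \<le> 1/2} \<in> sets borel" by measurable
  have ind: "indicator {x. \<bar>n \<bullet> x - c\<bar> \<le> 1/2} x = (indicator unit_slab (n \<bullet> x - c) :: real)" for x
  proof -
    have "\<bar>n \<bullet> x - c\<bar> \<le> 1/2 \<longleftrightarrow> -1/2 \<le> n \<bullet> x - c \<and> n \<bullet> x - c \<le> 1/2" by linarith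
    then show ?thesis by (simp only: indicator_def unit_slab_def mem_Collect_eq atLeastAtMost_iff)
  qed
  have S: "surface_measure {x. n \<bullet> x = c}
      = distr (restrict_space lborel {x. \<bar>n \<bullet> x - c\<bar> \<le> 1/2}) borel (\<lambda>x. x - (n \<bullet> x - c) *\<^sub>R n)"
    unfolding surface_measure_def closest_point_hyperplane[OF n, abs_def] closest_point_hyperplane(2)[OF n] ..
  have [measurable]: "(\<lambda>x. x - (n \<bullet> x - c) *\<^sub>R n)
      \<in> measurable (restrict_space lborel {x. \<bar>n \<bullet> x - c\<bar> \<le> 1/2}) borel"
    by (rule measurable_restrict_space1) measurable
  show "(LINT x|surface_measure {x. n \<bullet> x = c}. f x)
       = (LINT x|lborel. indicator unit_slab (n \<bullet> x - c) * f (x - (n \<bullet> x - c) *\<^sub>R n))"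
    unfolding S by (subst integral_distr, measurable) (simp add: integral_restrict_space ind del: le_divide_eq_numeral1)
  show "integrable (surface_measure {x. n \<bullet> x = c}) f
       \<longleftrightarrow> integrable lborel (\<lambda>x. indicator unit_slab (n \<bullet> x - c) * f (x - (n \<bullet> x - c) *\<^sub>R n))"
    unfolding S by (subst integrable_distr_eq, measurable) (simp add: integrable_restrict_space ind del: le_divide_eq_numeral1)
qed

text \<open>
  Stated for all directional derivatives, so that no basis of the space is involved.
\<close>

definition C1 :: "('a::euclidean_space \<Rightarrow> real) \<Rightarrow> bool" where
  "C1 f \<longleftrightarrow> (\<forall>x. f differentiable (at x)) \<and>
     (\<forall>v. continuous_on UNIV (\<lambda>x. frechet_derivative f (at x) v))"

definition face_integral :: "'a::euclidean_space set \<Rightarrow> ('a \<Rightarrow> real) \<Rightarrow> real" where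
  "face_integral F g = (LINT x:F|surface_measure (affine hull F). g x)"

lemma C1_has_derivative:
  assumes "C1 f"
  shows "(f has_derivative frechet_derivative f (at x)) (at x within S)"
  using assms by (meson C1_def frechet_derivative_works has_derivative_at_withinI)

lemma C1_continuous:
  assumes "C1 f"
  shows "continuous_on S f"
  by (meson C1_has_derivative[OF assms] continuous_on_eq_continuous_within has_derivative_continuous)

lemma C1_derivative_continuous:
  assumes "C1 f"
  shows "continuous_on S (\<lambda>x. frechet_derivative f (at x) v)"
proof -
  have "continuous_on UNIV (\<lambda>x. frechet_derivative f (at x) v)"
    using assms unfolding C1_def by blast
  then show ?thesis by (rule continuous_on_subset) simp
qed

text \<open>
  The normal makes the facet lie in a hyperplane \<open>n \<bullet> x = c\<close>, and both have dimension \<open>d - 1\<close>.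
\<close>

lemma facet_hyperplane:
  fixes K :: "'a::euclidean_space set"
  assumes dim: "aff_dim K = int DIM('a)" and F: "F facet_of K" and n: "outer_unit_normal K F n"
  obtains c where "affine hull F = {x. n \<bullet> x = c}" and "\<And>y. y \<in> K \<Longrightarrow> n \<bullet> y \<le> c"
proof -
  obtain x0 where x0: "x0 \<in> F" using F by (auto simp: facet_of_def)
  have FK: "F \<subseteq> K" by (rule facet_of_imp_subset[OF F])
  have norm: "norm n = 1" and le: "\<And>x y. x \<in> F \<Longrightarrow> y \<in> K \<Longrightarrow> n \<bullet> y \<le> n \<bullet> x"
    using n by (auto simp: outer_unit_normal_def inner_diff_right)
  have "F \<subseteq> {x. n \<bullet> x = n \<bullet> x0}"
    using le x0 FK by (auto intro!: antisym)
  then have sub: "affine hull F \<subseteq> {x. n \<bullet> x = n \<bullet> x0}"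
    by (intro hull_minimal affine_hyperplane)
  have "n \<noteq> 0" using norm by auto
  then have "affine hull F = {x. n \<bullet> x = n \<bullet> x0}"
    using F dim x0
    by (intro affine_dim_equal sub)
       (auto simp: affine_hyperplane facet_of_def)
  then show ?thesis using that le x0 by blast
qed

text \<open>
  A continuous function on a compact facet is bounded, and the prism over the facet is bounded, so
  all integrals exist.
\<close>

lemma face_integral_prism:
  fixes F :: "'a::euclidean_space set"
  assumes n: "norm n = 1" and F: "compact F" "affine hull F = {x. n \<bullet> x = c}"
    and g: "continuous_on F g" and \<psi>_def: "\<psi> = (\<lambda>x. indicator F x * g x)"
  shows "\<psi> \<in> borel_measurable borel"
    and "integrable lborel (\<lambda>x. indicator unit_slab (n \<bullet> x - c) * \<psi> (x - (n \<bullet> x - c) *\<^sub>R n))"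
    and "face_integral F g = (LINT x|lborel. indicator unit_slab (n \<bullet> x - c) * \<psi> (x - (n \<bullet> x - c) *\<^sub>R n))"
    and "set_integrable (surface_measure (affine hull F)) F g"
proof -
  show m [measurable]: "\<psi> \<in> borel_measurable borel"
    using borel_measurable_continuous_on_indicator[OF _ g] F
    by (simp add: \<psi>_def borel_closed compact_imp_closed)
  let ?f = "\<lambda>x. indicator unit_slab (n \<bullet> x - c) * \<psi> (x - (n \<bullet> x - c) *\<^sub>R n)"
  obtain R where R: "\<And>y. y \<in> F \<Longrightarrow> norm y \<le> R"
    using compact_imp_bounded[OF F(1)] by (auto simp: bounded_iff)
  obtain B where B: "\<And>y. y \<in> F \<Longrightarrow> norm (g y) \<le> B"
    using compact_imp_bounded[OF compact_continuous_image[OF g F(1)]] by (auto simp: bounded_iff)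
  have supp: "norm x \<le> R + 1" if "?f x \<noteq> 0" for x
  proof -
    from that have "x - (n \<bullet> x - c) *\<^sub>R n \<in> F" and s: "\<bar>n \<bullet> x - c\<bar> \<le> 1/2"
      by (auto simp: \<psi>_def indicator_def unit_slab_def abs_if field_simps split: if_splits)
    then have "norm (x - (n \<bullet> x - c) *\<^sub>R n) \<le> R" using R by blast
    moreover have "norm x \<le> norm (x - (n \<bullet> x - c) *\<^sub>R n) + norm ((n \<bullet> x - c) *\<^sub>R n)"
      by (metis diff_add_cancel norm_triangle_ineq)
    ultimately show ?thesis using s n by simp
  qed
  have "integrable lborel (\<lambda>x. indicator (cball 0 (R + 1)) x *\<^sub>R ?f x)"
  proof (rule integrableI_bounded_set_indicator[where B = "\<bar>B\<bar>"])
    show "emeasure lborel (cball 0 (R + 1) :: 'a set) < \<infinity>"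
      by (rule emeasure_lborel_cball_finite)
    show "AE x in lborel. x \<in> cball 0 (R + 1) \<longrightarrow> norm (?f x) \<le> \<bar>B\<bar>"
      using B by (auto simp: \<psi>_def indicator_def intro: order_trans[OF _ abs_ge_self])
  qed measurable
  also have "(\<lambda>x. indicator (cball 0 (R + 1)) x *\<^sub>R ?f x) = ?f"
  proof (rule ext)
    fix x show "indicator (cball 0 (R + 1)) x *\<^sub>R ?f x = ?f x"
      using supp[of x] by (cases "?f x = 0") (auto simp: indicator_def)
  qed
  finally show I: "integrable lborel ?f" .
  show "face_integral F g = (LINT x|lborel. ?f x)"
    using surface_measure_hyperplane(1)[OF n m, of c]
    by (simp add: face_integral_def set_lebesgue_integral_def F \<psi>_def)
  show "set_integrable (surface_measure (affine hull F)) F g"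
    using surface_measure_hyperplane(2)[OF n m, of c] I
    by (simp add: set_integrable_def F \<psi>_def)
qed

section \<open>The divergence theorem on a simplex\<close>

text \<open>
  The fundamental theorem of calculus on the chord of a convex body \<open>K\<close> in direction \<open>e\<close>, when all chords
  in this direction start on \<open>F1\<close> and end on \<open>F0\<close>. Writing the end points as projections of \<open>x\<close> onto the
  two hyperplanes, and putting indicators in front of them, covers also the lines that miss \<open>K\<close>.
\<close>

lemma integral_line_segment:
  fixes K :: "'a::euclidean_space set"
  assumes q: "C1 q" and "convex K"
    and n: "n0 \<bullet> e > 0" "n1 \<bullet> e < 0"
    and K0: "\<And>y. y \<in> K \<Longrightarrow> n0 \<bullet> y \<le> c0" and K1: "\<And>y. y \<in> K \<Longrightarrow> n1 \<bullet> y \<le> c1"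
    and F0: "F0 \<subseteq> K" "\<And>y. y \<in> F0 \<Longrightarrow> n0 \<bullet> y = c0"
    and F1: "F1 \<subseteq> K" "\<And>y. y \<in> F1 \<Longrightarrow> n1 \<bullet> y = c1"
    and exit0: "\<And>z. z \<in> K \<Longrightarrow> \<exists>s. z + s *\<^sub>R e \<in> F0"
    and exit1: "\<And>z. z \<in> K \<Longrightarrow> \<exists>s. z + s *\<^sub>R e \<in> F1"
  shows "(LINT t|lborel. indicator K (x + t *\<^sub>R e) * frechet_derivative q (at (x + t *\<^sub>R e)) e)
    = indicator F0 (x - ((n0 \<bullet> x - c0) / (n0 \<bullet> e)) *\<^sub>R e) * q (x - ((n0 \<bullet> x - c0) / (n0 \<bullet> e)) *\<^sub>R e)
    - indicator F1 (x - ((n1 \<bullet> x - c1) / (n1 \<bullet> e)) *\<^sub>R e) * q (x - ((n1 \<bullet> x - c1) / (n1 \<bullet> e)) *\<^sub>R e)"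
proof -
  (* The parameters at which the line meets the hyperplanes of \<open>F0\<close> and \<open>F1\<close>. *)
  define t0 where "t0 = - ((n0 \<bullet> x - c0) / (n0 \<bullet> e))"
  define t1 where "t1 = - ((n1 \<bullet> x - c1) / (n1 \<bullet> e))"
  have t0: "t = t0" if "x + t *\<^sub>R e \<in> F0" for t
    using F0(2)[OF that] n by (simp add: t0_def inner_add_right field_simps)
  have t1: "t = t1" if "x + t *\<^sub>R e \<in> F1" for t
    using F1(2)[OF that] n by (simp add: t1_def inner_add_right field_simps)
  have goal: ?thesis if "(LINT t|lborel. indicator K (x + t *\<^sub>R e) * frechet_derivative q (at (x + t *\<^sub>R e)) e)
    = indicator F0 (x + t0 *\<^sub>R e) * q (x + t0 *\<^sub>R e) - indicator F1 (x + t1 *\<^sub>R e) * q (x + t1 *\<^sub>R e)"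
    using that by (simp add: t0_def t1_def)
  show ?thesis
  proof (cases "\<exists>t. x + t *\<^sub>R e \<in> K")
    case False
    then have "x + t0 *\<^sub>R e \<notin> F0" "x + t1 *\<^sub>R e \<notin> F1" using F0 F1 by blast+
    then show ?thesis using False by (intro goal) (simp add: indicator_def)
  next
    case True
    then obtain t where t: "x + t *\<^sub>R e \<in> K" by blast
    obtain s0 s1 where "x + (t + s0) *\<^sub>R e \<in> F0" "x + (t + s1) *\<^sub>R e \<in> F1"
      using exit0[OF t] exit1[OF t] by (auto simp: algebra_simps)
    then have in0: "x + t0 *\<^sub>R e \<in> F0" and in1: "x + t1 *\<^sub>R e \<in> F1"
      using t0 t1 by metis+
    have range: "t1 \<le> r \<and> r \<le> t0" if "x + r *\<^sub>R e \<in> K" for r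
      using K0[OF that] K1[OF that] n by (simp add: t0_def t1_def inner_add_right field_simps)
    have K: "x + r *\<^sub>R e \<in> K \<longleftrightarrow> r \<in> {t1..t0}" for r
    proof
      show "r \<in> {t1..t0}" if "x + r *\<^sub>R e \<in> K" using range[OF that] by simp
    next
      assume r: "r \<in> {t1..t0}"
      have "convex ((\<lambda>r. x + r *\<^sub>R e) -` K)"
      proof (rule convexI)
        fix a b u v :: real
        assume ab: "a \<in> (\<lambda>r. x + r *\<^sub>R e) -` K" "b \<in> (\<lambda>r. x + r *\<^sub>R e) -` K"
          and uv: "0 \<le> u" "0 \<le> v" "u + v = 1"
        have "u *\<^sub>R (x + a *\<^sub>R e) + v *\<^sub>R (x + b *\<^sub>R e) \<in> K"
          using ab uv by (intro convexD[OF \<open>convex K\<close>]) auto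
        also have "u *\<^sub>R (x + a *\<^sub>R e) + v *\<^sub>R (x + b *\<^sub>R e) = (u + v) *\<^sub>R x + (u * a + v * b) *\<^sub>R e"
          by (simp add: algebra_simps)
        finally show "u *\<^sub>R a + v *\<^sub>R b \<in> (\<lambda>r. x + r *\<^sub>R e) -` K" by (simp add: uv)
      qed
      moreover have "t0 \<in> (\<lambda>r. x + r *\<^sub>R e) -` K" "t1 \<in> (\<lambda>r. x + r *\<^sub>R e) -` K"
        using in0 in1 F0 F1 by auto
      ultimately show "x + r *\<^sub>R e \<in> K"
        using r convex_contains_segment[of "(\<lambda>r. x + r *\<^sub>R e) -` K"] closed_segment_eq_real_ivl[of t1 t0]
        by fastforce
    qed
    have le: "t1 \<le> t0" using range[OF t] by linarith
    have D: "((\<lambda>t. q (x + t *\<^sub>R e)) has_vector_derivative frechet_derivative q (at (x + r *\<^sub>R e)) e) (at r within S)" for r S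
    proof -
      have "((\<lambda>t. x + t *\<^sub>R e) has_derivative (\<lambda>t. t *\<^sub>R e)) (at r within S)"
        by (auto intro!: derivative_eq_intros)
      from has_derivative_compose[OF this C1_has_derivative[OF q]]
      have "((\<lambda>t. q (x + t *\<^sub>R e)) has_derivative (\<lambda>t. frechet_derivative q (at (x + r *\<^sub>R e)) (t *\<^sub>R e))) (at r within S)" .
      moreover have "linear (frechet_derivative q (at (x + r *\<^sub>R e)))"
        using C1_has_derivative[OF q] has_derivative_linear by blast
      ultimately show ?thesis by (simp add: has_vector_derivative_def linear_cmul)
    qed
    have "(LINT r|lborel. indicator {t1..t0} r *\<^sub>R frechet_derivative q (at (x + r *\<^sub>R e)) e)
        = q (x + t0 *\<^sub>R e) - q (x + t1 *\<^sub>R e)"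
    proof (rule integral_FTC_atLeastAtMost[OF le D])
      show "continuous_on {t1..t0} (\<lambda>r. frechet_derivative q (at (x + r *\<^sub>R e)) e)"
        by (rule continuous_on_compose2[OF C1_derivative_continuous[OF q, of UNIV]])
           (auto intro!: continuous_intros)
    qed
    moreover have "(indicator K (x + r *\<^sub>R e) :: real) = indicator {t1..t0} r" for r
      using K[of r] by (simp add: indicator_def)
    ultimately show ?thesis using in0 in1 by (intro goal) simp
  qed
qed

text \<open>
  Integrating the chord formula over a slab transversal to \<open>e\<close>: the left side becomes a volume
  integral, and each end point term a surface integral.
\<close>

lemma divergence_two_facets:
  fixes K :: "'a::euclidean_space set"
  assumes q: "C1 q" and K: "convex K" "compact K"
    and n: "norm n0 = 1" "norm n1 = 1" "n0 \<bullet> e > 0" "n1 \<bullet> e < 0"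
    and K0: "\<And>y. y \<in> K \<Longrightarrow> n0 \<bullet> y \<le> c0" and K1: "\<And>y. y \<in> K \<Longrightarrow> n1 \<bullet> y \<le> c1"
    and F0: "F0 \<subseteq> K" "compact F0" "affine hull F0 = {x. n0 \<bullet> x = c0}"
    and F1: "F1 \<subseteq> K" "compact F1" "affine hull F1 = {x. n1 \<bullet> x = c1}"
    and exit0: "\<And>z. z \<in> K \<Longrightarrow> \<exists>s. z + s *\<^sub>R e \<in> F0"
    and exit1: "\<And>z. z \<in> K \<Longrightarrow> \<exists>s. z + s *\<^sub>R e \<in> F1"
  shows "(LINT x:K|lborel. frechet_derivative q (at x) e)
       = (n0 \<bullet> e) * face_integral F0 q + (n1 \<bullet> e) * face_integral F1 q"
proof -
  have nn: "n0 \<bullet> n0 = 1" "n1 \<bullet> n1 = 1" using n by (simp_all add: norm_eq_1)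
  have e0: "e \<noteq> 0" using n by auto
  (* Any \<open>m\<close> with \<open>m \<bullet> e = 1\<close> provides a transversal slab. *)
  define m where "m = e /\<^sub>R (e \<bullet> e)"
  have me: "m \<bullet> e = 1" using e0 by (simp add: m_def)
  define \<psi>0 where "\<psi>0 = (\<lambda>x. indicator F0 x * q x)"
  define \<psi>1 where "\<psi>1 = (\<lambda>x. indicator F1 x * q x)"
  note P0 = face_integral_prism[OF n(1) F0(2,3) C1_continuous[OF q] \<psi>0_def]
  note P1 = face_integral_prism[OF n(2) F1(2,3) C1_continuous[OF q] \<psi>1_def]
  have sub: "y \<in> F0 \<Longrightarrow> n0 \<bullet> y = c0" "y \<in> F1 \<Longrightarrow> n1 \<bullet> y = c1" for y
    using F0(3) F1(3) hull_subset[of F0 affine] hull_subset[of F1 affine] by auto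
  have ne: "n0 \<bullet> e \<noteq> 0" "n1 \<bullet> e \<noteq> 0" using n by auto
  note O0 = integral_oblique[OF P0(1) nn(1) ne(1) me P0(2)]
  note O1 = integral_oblique[OF P1(1) nn(2) ne(2) me P1(2)]
  let ?D = "\<lambda>x. indicator K x * frechet_derivative q (at x) e"
  let ?p0 = "\<lambda>x. x - ((n0 \<bullet> x - c0) / (n0 \<bullet> e)) *\<^sub>R e"
  let ?p1 = "\<lambda>x. x - ((n1 \<bullet> x - c1) / (n1 \<bullet> e)) *\<^sub>R e"
  have int: "integrable lborel ?D"
    using borel_integrable_compact[OF K(2) C1_derivative_continuous[OF q]] by simp
  have "(LINT x:K|lborel. frechet_derivative q (at x) e) = (LINT x|lborel. ?D x)"
    by (simp add: set_lebesgue_integral_def)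
  also have "\<dots> = (LINT x|lborel. indicator unit_slab (m \<bullet> x + 0) * (LINT t|lborel. ?D (x + t *\<^sub>R e)))"
    by (rule integral_along_lines[OF int me])
  also have "\<dots> = (LINT x|lborel. indicator unit_slab (m \<bullet> x) * \<psi>0 (?p0 x)
      - indicator unit_slab (m \<bullet> x) * \<psi>1 (?p1 x))"
    using integral_line_segment[OF q K(1) n(3,4) K0 K1 F0(1) sub(1) F1(1) sub(2) exit0 exit1]
    by (simp add: \<psi>0_def \<psi>1_def right_diff_distrib)
  also have "\<dots> = \<bar>n0 \<bullet> e\<bar> * face_integral F0 q - \<bar>n1 \<bullet> e\<bar> * face_integral F1 q"
    by (subst Bochner_Integration.integral_diff[OF O0(1) O1(1)]) (simp add: O0(2) O1(2) P0(3) P1(3))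
  finally show ?thesis using n by simp
qed

text \<open>
  Moving along \<open>a - b\<close> changes only the barycentric coordinates of \<open>a\<close> and \<open>b\<close>. Hence chords in this
  direction run from the facet opposite to \<open>a\<close> to the facet opposite to \<open>b\<close>, and every other facet contains
  both \<open>a\<close> and \<open>b\<close>, so that its normal is orthogonal to \<open>a - b\<close>.
\<close>

lemma divergence_theorem_simplex_edge:
  fixes C :: "'a::euclidean_space set"
  assumes C: "\<not> affine_dependent C" "card C = DIM('a) + 1" and K: "K = convex hull C"
    and \<nu>: "\<And>F. F facet_of K \<Longrightarrow> outer_unit_normal K F (\<nu> F)"
    and q: "C1 q" and ab: "a \<in> C" "b \<in> C" "a \<noteq> b"
  shows "(LINT x:K|lborel. frechet_derivative q (at x) (a - b))
       = (\<Sum>F | F facet_of K. (\<nu> F \<bullet> (a - b)) * face_integral F q)"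
proof -
  have fin: "finite C" by (rule aff_independent_finite[OF C(1)])
  have dim: "aff_dim K = int DIM('a)"
    using aff_dim_affine_independent[OF C(1)] C(2) by (simp add: K aff_dim_convex_hull)
  have KC: "convex K" "compact K" using fin by (auto simp: K finite_imp_compact_convex_hull)
  have CK: "C \<subseteq> K" by (simp add: K hull_subset)
  define f where "f u = convex hull (C - {u})" for u
  have facet: "F facet_of K \<longleftrightarrow> (\<exists>u\<in>C. F = f u)" for F
    using facet_of_convex_hull_affine_independent_alt[OF C(1), of F] C(2) DIM_positive[where 'a='a]
    unfolding K f_def by (auto simp: Suc_le_eq)
  have fK: "f u \<subseteq> K" for u unfolding f_def K by (rule hull_mono) auto
  have inf: "c \<in> f u" if "c \<in> C" "c \<noteq> u" for c u
    using that by (auto simp: f_def intro: hull_inc)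
  have compf: "compact (f u)" for u
    using fin by (auto simp: f_def finite_imp_compact_convex_hull)
  have move: "\<exists>s. z + s *\<^sub>R (c - u) \<in> f u" if z: "z \<in> K" and u: "u \<in> C" and c: "c \<in> C" "c \<noteq> u" for z c u
  proof -
    have ne: "C - {u} \<noteq> {}" using c by auto
    have "z \<in> convex hull (insert u (C - {u}))" using z u by (simp add: K insert_absorb)
    then obtain s r w where s: "s \<ge> 0" "r \<ge> 0" "s + r = 1" "w \<in> f u" "z = s *\<^sub>R u + r *\<^sub>R w"
      unfolding convex_hull_insert[OF ne] f_def by auto
    have "s *\<^sub>R c + r *\<^sub>R w \<in> f u"
      using inf[OF c] s by (intro convexD) (auto simp: f_def)
    also have "s *\<^sub>R c + r *\<^sub>R w = z + s *\<^sub>R (c - u)" by (simp add: s algebra_simps)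
    finally show ?thesis by blast
  qed
  have pos: "\<nu> (f u) \<bullet> (c - u) > 0" if u: "u \<in> C" and c: "c \<in> C" "c \<noteq> u" for u c
  proof (rule ccontr)
    assume neg: "\<not> ?thesis"
    have F: "f u facet_of K" using facet u by blast
    obtain d where d: "affine hull (f u) = {x. \<nu> (f u) \<bullet> x = d}" "\<And>y. y \<in> K \<Longrightarrow> \<nu> (f u) \<bullet> y \<le> d"
      using facet_hyperplane[OF dim F \<nu>[OF F]] by blast
    have on: "\<nu> (f u) \<bullet> x = d" if "x \<in> f u" for x
      using d(1) hull_subset[of "f u" affine] that by auto
    have "\<nu> (f u) \<bullet> u = d"
      using neg d(2)[of u] on[OF inf[OF c]] u CK by (auto simp: inner_diff_right)
    then have "C \<subseteq> {x. \<nu> (f u) \<bullet> x = d}" using on[OF inf[of _ u]] by auto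
    then have "affine hull C \<subseteq> {x. \<nu> (f u) \<bullet> x = d}"
      by (intro hull_minimal affine_hyperplane)
    moreover have "affine hull C = UNIV"
      using dim aff_dim_eq_full[of C] by (simp add: K aff_dim_convex_hull)
    ultimately have "\<nu> (f u) \<bullet> (x + \<nu> (f u)) = d" "\<nu> (f u) \<bullet> x = d" for x by auto
    then have "\<nu> (f u) \<bullet> \<nu> (f u) = 0" by (metis add_cancel_right_right inner_add_right)
    then show False using \<nu>[OF F] by (simp add: outer_unit_normal_def)
  qed
  have Fa: "f a facet_of K" and Fb: "f b facet_of K" using facet ab by blast+
  obtain ca where ca: "affine hull (f a) = {x. \<nu> (f a) \<bullet> x = ca}" "\<And>y. y \<in> K \<Longrightarrow> \<nu> (f a) \<bullet> y \<le> ca"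
    using facet_hyperplane[OF dim Fa \<nu>[OF Fa]] by blast
  obtain cb where cb: "affine hull (f b) = {x. \<nu> (f b) \<bullet> x = cb}" "\<And>y. y \<in> K \<Longrightarrow> \<nu> (f b) \<bullet> y \<le> cb"
    using facet_hyperplane[OF dim Fb \<nu>[OF Fb]] by blast
  have neg: "\<nu> (f a) \<bullet> (a - b) < 0"
    using pos[OF ab(1,2)] ab(3) by (simp add: inner_diff_right)
  have posb: "\<nu> (f b) \<bullet> (a - b) > 0" by (rule pos[OF ab(2,1,3)])
  have exit_a: "\<exists>s. z + s *\<^sub>R (a - b) \<in> f a" if z: "z \<in> K" for z
  proof -
    obtain s where "z + s *\<^sub>R (b - a) \<in> f a" using move[OF z ab(1,2)] ab(3) by auto
    then show ?thesis by (intro exI[of _ "-s"]) (simp add: algebra_simps)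
  qed
  have nrm: "norm (\<nu> F) = 1" if "F facet_of K" for F
    using \<nu>[OF that] by (simp add: outer_unit_normal_def)
  have "(LINT x:K|lborel. frechet_derivative q (at x) (a - b))
      = (\<nu> (f b) \<bullet> (a - b)) * face_integral (f b) q + (\<nu> (f a) \<bullet> (a - b)) * face_integral (f a) q"
    by (rule divergence_two_facets[OF q KC nrm[OF Fb] nrm[OF Fa] posb neg cb(2) ca(2)
          fK compf cb(1) fK compf ca(1) move[OF _ ab(2,1,3)] exit_a])
  also have "\<dots> = (\<Sum>F\<in>{f b, f a}. (\<nu> F \<bullet> (a - b)) * face_integral F q)"
    using posb neg by (subst sum.insert) auto
  also have "\<dots> = (\<Sum>F | F facet_of K. (\<nu> F \<bullet> (a - b)) * face_integral F q)"
  proof (rule sum.mono_neutral_left)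
    have "{F. F facet_of K} = f ` C" using facet by blast
    then show "finite {F. F facet_of K}" using fin by simp
    show "{f b, f a} \<subseteq> {F. F facet_of K}" using Fa Fb by simp
    show "\<forall>F\<in>{F. F facet_of K} - {f b, f a}. (\<nu> F \<bullet> (a - b)) * face_integral F q = 0"
    proof
      fix F assume F: "F \<in> {F. F facet_of K} - {f b, f a}"
      then obtain u where u: "u \<in> C" "F = f u" using facet by blast
      have "a \<noteq> u" "b \<noteq> u" using F u by auto
      then have "a \<in> F" "b \<in> F" using u inf ab by auto
      moreover have "F \<subseteq> K" using u fK by simp
      ultimately have "\<nu> F \<bullet> (a - b) \<le> 0" "\<nu> F \<bullet> (b - a) \<le> 0"
        using \<nu>[of F] F by (auto simp: outer_unit_normal_def)
      then have "\<nu> F \<bullet> (a - b) = 0" by (simp add: inner_diff_right)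
      then show "(\<nu> F \<bullet> (a - b)) * face_integral F q = 0" by simp
    qed
  qed
  finally show ?thesis .
qed

text \<open>
  Both sides are linear in \<open>v\<close>, and the edges that meet at a vertex span the space.
\<close>

theorem divergence_theorem_simplex:
  fixes K :: "'a::euclidean_space set"
  assumes K: "int DIM('a) simplex K"
    and \<nu>: "\<And>F. F facet_of K \<Longrightarrow> outer_unit_normal K F (\<nu> F)"
    and q: "C1 q"
  shows "(LINT x:K|lborel. frechet_derivative q (at x) v)
       = (\<Sum>F | F facet_of K. (\<nu> F \<bullet> v) * face_integral F q)"
proof -
  obtain C where C: "finite C" "\<not> affine_dependent C" "card C = DIM('a) + 1" "K = convex hull C"
    using K unfolding simplex by (auto simp: nat_int_add)
  have lin: "linear (frechet_derivative q (at x))" for x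
    using C1_has_derivative[OF q] has_derivative_linear by blast
  have int: "set_integrable lborel K (\<lambda>x. frechet_derivative q (at x) v)" for v
    using borel_integrable_compact[OF compact_simplex[OF K] C1_derivative_continuous[OF q, of K v]]
    by (simp add: set_integrable_def)
  define V where "V = {v. (LINT x:K|lborel. frechet_derivative q (at x) v)
      = (\<Sum>F | F facet_of K. (\<nu> F \<bullet> v) * face_integral F q)}"
  have "subspace V"
    unfolding subspace_def V_def mem_Collect_eq
    by (auto simp: linear_0[OF lin] linear_add[OF lin] linear_cmul[OF lin] set_integral_add int
        inner_add_right distrib_right sum.distrib sum_distrib_left mult.assoc)
  obtain b where b: "b \<in> C" using C by fastforce
  have "(\<lambda>x. x - b) ` C \<subseteq> V"
    using divergence_theorem_simplex_edge[OF C(2,3,4) \<nu> q _ b] linear_0[OF lin]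
    by (fastforce simp: V_def)
  then have span: "span ((\<lambda>x. x - b) ` C) \<subseteq> V"
    using \<open>subspace V\<close> by (rule span_minimal)
  have "dim ((\<lambda>x. x - b) ` C) = DIM('a)"
    using affine_independent_card_dim_diffs[OF C(2) b] C(3) by simp
  then have "span ((\<lambda>x. x - b) ` C) = UNIV" by (simp add: dim_eq_full)
  then show ?thesis using span by (auto simp: V_def)
qed

section \<open>Elements and facets of a conforming mesh\<close>

text \<open>
  Near a relative interior point \<open>z\<close> of the common face, a step from \<open>z\<close> towards \<open>b\<close> is a step towards \<open>a\<close>
  combined with a small displacement within the hyperplane of \<open>F\<close>, which does not leave \<open>F\<close>. So it ends
  in both sets, strictly on the side of \<open>a\<close> and \<open>b\<close>.
\<close>

lemma convex_same_side_overlap: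
  fixes K L :: "'a::euclidean_space set"
  assumes K: "convex K" "F \<subseteq> K" and L: "convex L" "F \<subseteq> L" and F: "convex F" "F \<noteq> {}"
    and H: "affine hull F = {x. n \<bullet> x = c}"
    and a: "a \<in> K" "n \<bullet> a < c" and b: "b \<in> L" "n \<bullet> b < c"
  obtains w where "w \<in> K" "w \<in> L" "n \<bullet> w < c"
proof -
  obtain z where "z \<in> rel_interior F" using F rel_interior_eq_empty by blast
  then obtain \<delta> where z: "z \<in> F" and \<delta>: "\<delta> > 0" "ball z \<delta> \<inter> affine hull F \<subseteq> F"
    by (auto simp: mem_rel_interior_ball)
  have nz: "n \<bullet> z = c" using z hull_subset[of F affine] H by auto
  define \<alpha> where "\<alpha> = (n \<bullet> b - c) / (n \<bullet> a - c)"
  have \<alpha>: "\<alpha> > 0" using a b by (simp add: \<alpha>_def divide_neg_neg)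
  (* \<open>b - z\<close> is split into a multiple of \<open>a - z\<close> and a vector parallel to \<open>F\<close>. *)
  define h where "h = (b - z) - \<alpha> *\<^sub>R (a - z)"
  have nh: "n \<bullet> h = 0" using a by (simp add: h_def inner_diff_right nz \<alpha>_def)
  (* The three bounds keep the step within the segment from \<open>z\<close> to \<open>b\<close>, make \<open>\<epsilon> \<alpha> \<le> 1/2\<close> a weight
     of \<open>a\<close> in a convex combination, and keep the displacement by \<open>h\<close> inside the ball. *)
  define \<epsilon> where "\<epsilon> = min (1/2) (min (1 / (2 * \<alpha>)) (\<delta> / (4 * (norm h + 1))))"
  have h1: "norm h + 1 > 0" using norm_ge_zero[of h] by linarith
  have \<epsilon>: "\<epsilon> > 0" "\<epsilon> \<le> 1/2" "\<epsilon> \<le> 1 / (2 * \<alpha>)" "\<epsilon> \<le> \<delta> / (4 * (norm h + 1))"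
    using \<alpha> \<delta>(1) h1 unfolding \<epsilon>_def by (simp_all only: min_less_iff_conj min.cobounded1
        min.coboundedI2 min.cobounded2) (simp_all add: divide_pos_pos)
  have \<epsilon>\<alpha>: "\<epsilon> * \<alpha> \<le> 1/2" "\<epsilon> * \<alpha> > 0" using \<epsilon> \<alpha> by (auto simp: field_simps)
  define r where "r = \<epsilon> / (1 - \<epsilon> * \<alpha>)"
  have r: "r \<ge> 0" "r \<le> 2 * \<epsilon>" using \<epsilon> \<epsilon>\<alpha> by (auto simp: r_def field_simps)
  have "norm (r *\<^sub>R h) \<le> 2 * \<epsilon> * norm h" using r by (simp add: mult_right_mono)
  also have "\<dots> \<le> 2 * (\<delta> / (4 * (norm h + 1))) * (norm h + 1)"
    using \<epsilon> h1 by (intro mult_mono) auto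
  also have "\<dots> = \<delta> / 2" using h1 by (simp add: field_simps)
  finally have "norm (r *\<^sub>R h) < \<delta>" using \<delta>(1) by linarith
  then have "z + r *\<^sub>R h \<in> ball z \<delta>" by (simp add: dist_norm)
  moreover have "z + r *\<^sub>R h \<in> affine hull F" by (simp add: H inner_add_right nz nh)
  ultimately have y: "z + r *\<^sub>R h \<in> K" using \<delta>(2) K(2) by blast
  define w where "w = (1 - \<epsilon>) *\<^sub>R z + \<epsilon> *\<^sub>R b"
  have "w \<in> L" unfolding w_def using L z b \<epsilon> by (intro convexD) auto
  moreover have "w = (1 - \<epsilon> * \<alpha>) *\<^sub>R (z + r *\<^sub>R h) + (\<epsilon> * \<alpha>) *\<^sub>R a"
  proof -
    have "(1 - \<epsilon> * \<alpha>) * r = \<epsilon>" using \<epsilon>\<alpha> by (simp add: r_def)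
    then have "(1 - \<epsilon> * \<alpha>) *\<^sub>R (z + r *\<^sub>R h) = (1 - \<epsilon> * \<alpha>) *\<^sub>R z + \<epsilon> *\<^sub>R h"
      by (simp add: scaleR_add_right)
    then show ?thesis by (simp add: w_def h_def algebra_simps)
  qed
  then have "w \<in> K" using K(1) y a \<epsilon>\<alpha> by (auto intro!: convexD)
  moreover have "n \<bullet> w < c"
  proof -
    have "n \<bullet> w = c + \<epsilon> * (n \<bullet> b - c)" by (simp add: w_def inner_add_right nz algebra_simps)
    moreover have "\<epsilon> * (n \<bullet> b - c) < 0" using \<epsilon> b by (simp add: mult_less_0_iff)
    ultimately show ?thesis by linarith
  qed
  ultimately show ?thesis using that by blast
qed

lemma conforming_meshD:
  fixes M :: "'n::finite mesh"
  assumes "conforming_mesh M"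
  shows "open (region M)" "bounded (region M)"
    and "\<exists>P. finite P \<and> (\<forall>Q\<in>P. polytope Q) \<and> region M = interior (\<Union>P)"
    and "finite (cells M)"
    and "K \<in> cells M \<Longrightarrow> L \<in> cells M \<Longrightarrow> K \<inter> L face_of K"
    and "K \<in> cells M \<Longrightarrow> int DIM(real^'n) simplex K"
    and "\<Union>(cells M) = closure (region M)"
    and "F \<in> interior_faces M \<Longrightarrow> Kplus M F \<in> cells M \<and> F facet_of Kplus M F \<and>
        Kminus M F \<in> cells M \<and> F facet_of Kminus M F \<and> Kplus M F \<noteq> Kminus M F \<and>
        outer_unit_normal (Kplus M F) F (normal M F)"
    and "F \<in> boundary_faces M \<Longrightarrow> Kplus M F \<in> cells M \<and> F facet_of Kplus M F \<and>
        outer_unit_normal (Kplus M F) F (normal M F)"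
proof -
  note c = assms[unfolded conforming_mesh_def]
  note p = c[THEN conjunct1, unfolded polyhedral_domain_def]
  note t = c[THEN conjunct2, THEN conjunct1, unfolded triangulation_def]
  note r = c[THEN conjunct2, THEN conjunct2]
  note r2 = r[THEN conjunct2, THEN conjunct2]
  show "open (region M)" "bounded (region M)"
    "\<exists>P. finite P \<and> (\<forall>Q\<in>P. polytope Q) \<and> region M = interior (\<Union>P)"
    using p by blast+
  show "finite (cells M)" by (rule t[THEN conjunct1])
  show "K \<in> cells M \<Longrightarrow> L \<in> cells M \<Longrightarrow> K \<inter> L face_of K" using t by blast
  show "K \<in> cells M \<Longrightarrow> int DIM(real^'n) simplex K" using r[THEN conjunct1] by simp
  show "\<Union>(cells M) = closure (region M)" by (rule r[THEN conjunct2, THEN conjunct1])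
  show "F \<in> interior_faces M \<Longrightarrow> Kplus M F \<in> cells M \<and> F facet_of Kplus M F \<and>
        Kminus M F \<in> cells M \<and> F facet_of Kminus M F \<and> Kplus M F \<noteq> Kminus M F \<and>
        outer_unit_normal (Kplus M F) F (normal M F)"
    by (rule r2[THEN conjunct1, THEN bspec])
  show "F \<in> boundary_faces M \<Longrightarrow> Kplus M F \<in> cells M \<and> F facet_of Kplus M F \<and>
        outer_unit_normal (Kplus M F) F (normal M F)"
    by (rule r2[THEN conjunct2, THEN bspec])
qed

lemma mesh_cell:
  fixes M :: "'n::finite mesh"
  assumes "conforming_mesh M" and "K \<in> cells M"
  shows "int DIM(real^'n) simplex K" "convex K" "compact K" "aff_dim K = int DIM(real^'n)" "interior K \<noteq> {}"
    and "closure (interior K) = K" "finite {F. F facet_of K}"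
proof -
  show s: "int DIM(real^'n) simplex K" by (rule conforming_meshD(6)[OF assms])
  then show c: "convex K" "compact K" by (auto dest: convex_simplex compact_simplex)
  show d: "aff_dim K = int DIM(real^'n)" by (rule aff_dim_simplex[OF s])
  then have "K \<noteq> {}" by auto
  then show i: "interior K \<noteq> {}"
    using c rel_interior_eq_empty interior_rel_interior[OF d] by metis
  show "closure (interior K) = K"
    using convex_closure_interior[OF c(1) i] c by (simp add: compact_imp_closed)
  show "finite {F. F facet_of K}"
    using simplex_imp_polytope[OF s] finite_polytope_facets by blast
qed

lemma mesh_Int_face:
  fixes M :: "'n::finite mesh"
  assumes "conforming_mesh M" "K \<in> cells M" "L \<in> cells M"
  shows "K \<inter> L face_of K" and "K \<inter> L face_of L"
  using conforming_meshD(5)[OF assms] conforming_meshD(5)[OF assms(1,3,2)] by (simp_all only: Int_commute[of L K])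

lemma mesh_Int_proper:
  fixes M :: "'n::finite mesh"
  assumes M: "conforming_mesh M" and K: "K \<in> cells M" and L: "L \<in> cells M" and "K \<noteq> L"
  shows "K \<inter> L \<noteq> K"
proof
  assume eq: "K \<inter> L = K"
  then have "K face_of L" using mesh_Int_face[OF M K L] by simp
  then have "aff_dim K < aff_dim L"
    using face_of_aff_dim_lt mesh_cell(2)[OF M L] \<open>K \<noteq> L\<close> by blast
  then show False using mesh_cell(4)[OF M K] mesh_cell(4)[OF M L] by simp
qed

text \<open>
  The intersection is a proper face of \<open>K\<close>, and between a facet and \<open>K\<close> there is no room for a further
  dimension.
\<close>

lemma mesh_Int_eq_facet:
  fixes M :: "'n::finite mesh"
  assumes M: "conforming_mesh M" and K: "K \<in> cells M" and L: "L \<in> cells M" and "K \<noteq> L"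
    and F: "F facet_of K" "F \<subseteq> L"
  shows "K \<inter> L = F"
proof (rule ccontr)
  assume ne: "K \<inter> L \<noteq> F"
  have I: "K \<inter> L face_of K" using mesh_Int_face[OF M K L] by simp
  have lt: "aff_dim (K \<inter> L) < aff_dim K"
    using face_of_aff_dim_lt[OF mesh_cell(2)[OF M K] I] mesh_Int_proper[OF M K L] assms(4) by blast
  have "F face_of K \<inter> L"
    by (rule face_of_subset[OF facet_of_imp_face_of[OF F(1)]])
       (use facet_of_imp_subset[OF F(1)] F(2) in blast)+
  then have "aff_dim F < aff_dim (K \<inter> L)"
    using face_of_aff_dim_lt[of "K \<inter> L" F] ne face_of_imp_convex[OF I] by metis
  then show False using lt F(1) by (simp add: facet_of_def)
qed

lemma mesh_cell_off_hyperplane: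
  fixes M :: "'n::finite mesh"
  assumes M: "conforming_mesh M" and K: "K \<in> cells M" and n: "norm n = 1"
  shows "\<exists>a\<in>K. n \<bullet> a \<noteq> c"
proof (rule ccontr)
  assume "\<not> ?thesis"
  then have "K \<subseteq> {x. n \<bullet> x = c}" by auto
  then have "aff_dim K \<le> aff_dim {x. n \<bullet> x = c}" by (rule aff_dim_subset)
  moreover have "n \<noteq> 0" using n by auto
  ultimately show False using mesh_cell(4)[OF M K] by simp
qed

text \<open>
  If a point of \<open>L\<close> were on the side of \<open>K\<close>, the two elements would overlap off their common
  facet.
\<close>

lemma mesh_opposite_normal:
  fixes M :: "'n::finite mesh"
  assumes M: "conforming_mesh M" and K: "K \<in> cells M" and L: "L \<in> cells M" and "K \<noteq> L"
    and F: "F facet_of K" "F facet_of L" and n: "outer_unit_normal K F n"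
  shows "outer_unit_normal L F (- n)"
proof -
  obtain c where c: "affine hull F = {x. n \<bullet> x = c}" "\<And>y. y \<in> K \<Longrightarrow> n \<bullet> y \<le> c"
    using facet_hyperplane[OF mesh_cell(4)[OF M K] F(1) n] by blast
  have nrm: "norm n = 1" using n by (simp add: outer_unit_normal_def)
  have FL: "F \<subseteq> L" and FK: "F \<subseteq> K" using F facet_of_imp_subset by auto
  have on: "n \<bullet> x = c" if "x \<in> F" for x using c(1) hull_subset[of F affine] that by auto
  obtain a where a: "a \<in> K" "n \<bullet> a < c"
    using mesh_cell_off_hyperplane[OF M K nrm] c(2) by (metis order_le_less)
  have ge: "n \<bullet> y \<ge> c" if y: "y \<in> L" for y
  proof (rule ccontr)
    assume "\<not> ?thesis"
    then have "n \<bullet> y < c" by simp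
    moreover have "convex F" "F \<noteq> {}"
      using F(1) facet_of_imp_face_of[OF F(1)] face_of_imp_convex by (auto simp: facet_of_def)
    ultimately obtain w where "w \<in> K" "w \<in> L" "n \<bullet> w < c"
      using convex_same_side_overlap[OF mesh_cell(2)[OF M K] FK mesh_cell(2)[OF M L] FL _ _ c(1) a y] by blast
    then show False using mesh_Int_eq_facet[OF M K L assms(4) F(1) FL] on by auto
  qed
  show ?thesis using nrm ge on by (auto simp: outer_unit_normal_def inner_diff_right)
qed

text \<open>
  Of three elements at the same facet, the last two would both be opposite to the first and also
  opposite to each other.
\<close>

lemma mesh_at_most_two_cells:
  fixes M :: "'n::finite mesh"
  assumes M: "conforming_mesh M" and KL: "K \<in> cells M" "L \<in> cells M" "K \<noteq> L"
    and J: "J \<in> cells M" and F: "F facet_of K" "F facet_of L" "F facet_of J"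
    and n: "outer_unit_normal K F n"
  shows "J = K \<or> J = L"
proof (rule ccontr)
  assume "\<not> ?thesis"
  then have ne: "K \<noteq> J" "L \<noteq> J" by auto
  have nL: "outer_unit_normal L F (- n)" by (rule mesh_opposite_normal[OF M KL F(1,2) n])
  have "outer_unit_normal J F (- n)" by (rule mesh_opposite_normal[OF M KL(1) J ne(1) F(1,3) n])
  moreover have "outer_unit_normal J F (- (- n))"
    by (rule mesh_opposite_normal[OF M KL(2) J ne(2) F(2,3) nL])
  moreover obtain x where x: "x \<in> F" using F(1) by (auto simp: facet_of_def)
  ultimately have "n \<bullet> y = n \<bullet> x" if "y \<in> J" for y
    using that by (force simp: outer_unit_normal_def inner_diff_right)
  then show False
    using mesh_cell_off_hyperplane[OF M J, of n "n \<bullet> x"] n by (auto simp: outer_unit_normal_def)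
qed

text \<open>
  Around a relative interior point of the facet that lies in the domain, the domain is covered
  by elements. If another element contains the point, it has the whole facet as a facet, and the face is
  interior; if none does, the point is interior to \<open>K\<close>, which is impossible on a proper face.
\<close>

lemma mesh_face_boundary:
  fixes M :: "'n::finite mesh"
  assumes M: "conforming_mesh M" and F: "F \<in> faces M" "F \<notin> interior_faces M"
  shows "F \<in> boundary_faces M"
proof -
  obtain K where K: "K \<in> cells M" "F facet_of K" using F(1) by (auto simp: faces_def)
  have FK: "F face_of K" "F \<subseteq> K" "F \<noteq> K"
    using K(2) facet_of_imp_face_of[OF K(2)] facet_of_imp_subset[OF K(2)] by auto
  have open_R: "open (region M)" and cov: "\<Union>(cells M) = closure (region M)"
    by (rule conforming_meshD[OF M])+
  have "F \<inter> region M = {}"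
  proof (rule ccontr)
    assume "F \<inter> region M \<noteq> {}"
    moreover have "closure (rel_interior F) = closure F"
      by (rule convex_closure_rel_interior[OF face_of_imp_convex[OF FK(1)]])
    ultimately have "rel_interior F \<inter> region M \<noteq> {}"
      using open_R closure_subset[of F] open_Int_closure_eq_empty[of "region M" "rel_interior F"] by blast
    then obtain x where x: "x \<in> rel_interior F" "x \<in> region M" by blast
    have xF: "x \<in> F" using x(1) rel_interior_subset by blast
    show False
    proof (cases "\<exists>L\<in>cells M. L \<noteq> K \<and> x \<in> L")
      case True
      then obtain L where L: "L \<in> cells M" "L \<noteq> K" "x \<in> L" by blast
      have "F \<subseteq> K \<inter> L"
        using subset_of_face_of[of "K \<inter> L" K F] mesh_Int_face[OF M K(1) L(1)] FK x(1) xF L(3) by blast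
      then have "F = K \<inter> L" using mesh_Int_eq_facet[OF M K(1) L(1)] L K(2) by auto
      then have "F face_of L" using mesh_Int_face[OF M K(1) L(1)] by simp
      then have "F facet_of L"
        using K(2) mesh_cell(4)[OF M K(1)] mesh_cell(4)[OF M L(1)] by (simp add: facet_of_def)
      then show False using F(2) K L by (auto simp: interior_faces_def)
    next
      case False
      (* An open neighbourhood of \<open>x\<close> that meets no element other than \<open>K\<close>. *)
      define W where "W = region M \<inter> - \<Union>(cells M - {K})"
      have "closed (\<Union>(cells M - {K}))"
        using conforming_meshD(4)[OF M] mesh_cell(3)[OF M] by (intro closed_Union) (auto intro: compact_imp_closed)
      then have "open W" unfolding W_def using open_R by (intro open_Int) auto
      moreover have "W \<subseteq> K"
        using cov closure_subset[of "region M"] by (auto simp: W_def)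
      moreover have "x \<in> W" using x False by (auto simp: W_def)
      ultimately have "x \<in> interior K" by (meson interiorI)
      then show False using face_of_disjoint_interior[OF FK(1,3)] xF by blast
    qed
  qed
  moreover have "F \<subseteq> closure (region M)" using K(1) FK(2) cov by auto
  ultimately show ?thesis
    using F(1) open_R by (auto simp: boundary_faces_def frontier_def interior_open)
qed

text \<open>
  The domain is the interior of a closed set, so it has no slits: it contains the interior of its
  closure.
\<close>

lemma mesh_interior_cell_subset:
  fixes M :: "'n::finite mesh"
  assumes M: "conforming_mesh M" and K: "K \<in> cells M"
  shows "interior K \<subseteq> region M"
proof -
  obtain P where P: "finite P" "\<forall>Q\<in>P. polytope Q" "region M = interior (\<Union>P)"
    using conforming_meshD(3)[OF M] by blast
  have "closed (\<Union>P)"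
    using P by (intro closed_Union) (auto intro: polytope_imp_closed)
  then have "closure (region M) \<subseteq> \<Union>P"
    using P(3) interior_subset closure_minimal by metis
  moreover have "K \<subseteq> closure (region M)"
    using conforming_meshD(7)[OF M] K by blast
  ultimately have "K \<subseteq> \<Union>P" by blast
  then show ?thesis unfolding P(3) by (rule interior_mono)
qed

lemma mesh_interiors_disjoint:
  fixes M :: "'n::finite mesh"
  assumes M: "conforming_mesh M" and K: "K \<in> cells M" and L: "L \<in> cells M" and "K \<noteq> L"
  shows "interior K \<inter> L = {}"
proof -
  have "(K \<inter> L) \<inter> interior K = {}"
    using face_of_disjoint_interior mesh_Int_face[OF M K L] mesh_Int_proper[OF M K L assms(4)] by blast
  then show ?thesis using interior_subset by blast
qed

text \<open>
  The closed elements and the domain agree up to the boundaries of the elements, which are null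
  sets. The function \<open>f\<close> may be arbitrary on the skeleton; its measurability follows from that of the
  functions \<open>g K\<close>.
\<close>

lemma integral_region_sum_cells:
  fixes M :: "'n::finite mesh" and f :: "real^'n \<Rightarrow> real"
  assumes M: "conforming_mesh M"
    and f: "\<And>K x. K \<in> cells M \<Longrightarrow> x \<in> interior K \<Longrightarrow> f x = g K x"
    and g: "\<And>K. K \<in> cells M \<Longrightarrow> continuous_on K (g K)"
  shows "integrable (lebesgue_on (region M)) f"
    and "(LINT x|lebesgue_on (region M). f x) = (\<Sum>K\<in>cells M. LINT x:K|lborel. g K x)"
proof -
  note fin = conforming_meshD(4)[OF M]
  have open_R: "open (region M)" and cov: "\<Union>(cells M) = closure (region M)"
    by (rule conforming_meshD[OF M])+
  have R[measurable]: "region M \<in> sets lebesgue" using open_R by auto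
  define G where "G = (\<lambda>x. \<Sum>K\<in>cells M. indicator K x * g K x)"
  have Gi: "integrable lborel (\<lambda>x. indicator K x * g K x)" if "K \<in> cells M" for K
    using borel_integrable_compact[OF mesh_cell(3)[OF M that] g[OF that]] by simp
  have G: "integrable lborel G" unfolding G_def by (intro Bochner_Integration.integrable_sum Gi)
  have GI: "(LINT x|lborel. G x) = (\<Sum>K\<in>cells M. LINT x:K|lborel. g K x)"
    unfolding G_def set_lebesgue_integral_def real_scaleR_def
    by (rule Bochner_Integration.integral_sum) (rule Gi)
  have Gm: "G \<in> borel_measurable lborel" using G by (rule borel_measurable_integrable)
  have GL: "integrable lebesgue G" and GIL: "(LINT x|lebesgue. G x) = (LINT x|lborel. G x)"
    using G Gm by (auto simp: integrable_completion integral_completion)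
  define N where "N = \<Union>(frontier ` cells M)"
  have N: "negligible N"
    unfolding N_def using fin mesh_cell(2)[OF M] by (intro negligible_Union) (auto intro: negligible_convex_frontier)
  let ?h = "\<lambda>x. indicator (region M) x *\<^sub>R f x"
  have eq: "?h x = G x" if "x \<in> UNIV - N" for x
  proof (cases "\<exists>K\<in>cells M. x \<in> K")
    case True
    then obtain K where K: "K \<in> cells M" "x \<in> K" by blast
    have "x \<notin> frontier K" using that K by (auto simp: N_def)
    then have xi: "x \<in> interior K" using K(2) closure_subset by (auto simp: frontier_def)
    have "G x = (\<Sum>L\<in>{K}. indicator L x * g L x)"
      unfolding G_def
    proof (rule sum.mono_neutral_right[OF fin])
      show "\<forall>L\<in>cells M - {K}. indicator L x * g L x = 0"
        using mesh_interiors_disjoint[OF M K(1)] xi by (auto simp: indicator_def)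
    qed (use K in auto)
    then show ?thesis
      using K xi f mesh_interior_cell_subset[OF M K(1)] by (auto simp: indicator_def)
  next
    case False
    then have "G x = 0" by (auto simp: G_def intro!: sum.neutral)
    moreover have "x \<notin> region M" using False cov closure_subset[of "region M"] by blast
    ultimately show ?thesis by simp
  qed
  have "G absolutely_integrable_on UNIV" using GL by (simp add: set_integrable_def)
  then have "?h absolutely_integrable_on UNIV" by (rule absolutely_integrable_spike[OF _ N eq])
  then have hi: "integrable lebesgue ?h" by (simp add: set_integrable_def)
  then show "integrable (lebesgue_on (region M)) f" by (simp add: integrable_restrict_space)
  have "(LINT x|lebesgue_on (region M). f x) = (LINT x|lebesgue. ?h x)"
    by (simp add: integral_restrict_space)
  also have "\<dots> = integral UNIV ?h" by (rule integral_lebesgue[OF hi, symmetric])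
  also have "\<dots> = integral UNIV G" by (rule integral_spike[OF N]) (use eq in auto)
  also have "\<dots> = (LINT x|lebesgue. G x)" by (rule integral_lebesgue[OF GL])
  finally show "(LINT x|lebesgue_on (region M). f x) = (\<Sum>K\<in>cells M. LINT x:K|lborel. g K x)"
    by (simp add: GIL GI)
qed

section \<open>Smooth and piecewise smooth functions\<close>

lemma C1I:
  assumes "\<And>x. (f has_derivative f' x) (at x)" and "\<And>v. continuous_on UNIV (\<lambda>x. f' x v)"
  shows "C1 f"
proof -
  have "frechet_derivative f (at x) = f' x" for x
    using frechet_derivative_at[OF assms(1)] by simp
  then show ?thesis using assms by (auto simp: C1_def differentiable_def)
qed

lemma C1_const: "C1 (\<lambda>x. c)"
  by (rule C1I[where f' = "\<lambda>x v. 0"]) auto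

lemma C1_component: "C1 (\<lambda>x::real^'n::finite. x $ i)"
  by (rule C1I[where f' = "\<lambda>x v. v $ i"]) (auto intro!: bounded_linear_imp_has_derivative bounded_linear_vec_nth)

lemma C1_add:
  assumes "C1 f" "C1 g"
  shows "C1 (\<lambda>x. f x + g x)"
  by (rule C1I[OF has_derivative_add[OF C1_has_derivative[OF assms(1)] C1_has_derivative[OF assms(2)]]])
     (intro continuous_intros C1_derivative_continuous assms)

lemma frechet_derivative_mult:
  assumes "C1 f" "C1 g"
  shows "frechet_derivative (\<lambda>x. f x * g x) (at x) v
       = f x * frechet_derivative g (at x) v + frechet_derivative f (at x) v * g x"
  using frechet_derivative_at[OF has_derivative_mult[OF C1_has_derivative[OF assms(1)] C1_has_derivative[OF assms(2)]]]
  by metis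

lemma C1_mult:
  assumes "C1 f" "C1 g"
  shows "C1 (\<lambda>x. f x * g x)"
  by (rule C1I[OF has_derivative_mult[OF C1_has_derivative[OF assms(1)] C1_has_derivative[OF assms(2)]]])
     (intro continuous_intros C1_derivative_continuous C1_continuous assms)

lemma C1_sum: "(\<And>i. i \<in> I \<Longrightarrow> C1 (f i)) \<Longrightarrow> C1 (\<lambda>x. \<Sum>i\<in>I. f i x)"
  by (induction I rule: infinite_finite_induct) (auto intro: C1_const C1_add)

lemma frechet_derivative_sum:
  assumes "finite I" "\<And>i. i \<in> I \<Longrightarrow> C1 (f i)"
  shows "frechet_derivative (\<lambda>x. \<Sum>i\<in>I. f i x) (at x) v = (\<Sum>i\<in>I. frechet_derivative (f i) (at x) v)"
proof -
  have "((\<lambda>x. \<Sum>i\<in>I. f i x) has_derivative (\<lambda>v. \<Sum>i\<in>I. frechet_derivative (f i) (at x) v)) (at x)"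
    by (rule has_derivative_sum) (rule C1_has_derivative[OF assms(2)])
  from frechet_derivative_at[OF this] show ?thesis by metis
qed

lemma C1_prod: "(\<And>i. i \<in> I \<Longrightarrow> C1 (f i)) \<Longrightarrow> C1 (\<lambda>x. \<Prod>i\<in>I. f i x)"
  by (induction I rule: infinite_finite_induct) (auto intro: C1_const C1_mult)

lemma C1_power: "C1 f \<Longrightarrow> C1 (\<lambda>x. f x ^ k)"
  by (induction k) (auto intro: C1_const C1_mult)

definition C1_vec :: "(real^'n::finite \<Rightarrow> real^'n) \<Rightarrow> bool" where
  "C1_vec p \<longleftrightarrow> (\<forall>i. C1 (\<lambda>x. p x $ i))"

lemma polys_C1: "p \<in> polys j \<Longrightarrow> C1 p"
proof -
  assume "p \<in> polys j"
  then obtain c where "\<And>x. p x = (\<Sum>\<alpha> | (\<Sum>i\<in>UNIV. \<alpha> i) \<le> j. c \<alpha> * (\<Prod>i\<in>UNIV. (x $ i) ^ \<alpha> i))"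
    unfolding polys_def by blast
  then have "p = (\<lambda>x. \<Sum>\<alpha> | (\<Sum>i\<in>UNIV. \<alpha> i) \<le> j. c \<alpha> * (\<Prod>i\<in>UNIV. (x $ i) ^ \<alpha> i))" by (rule ext)
  moreover have "C1 \<dots>"
    by (intro C1_sum C1_mult C1_const C1_prod C1_power C1_component)
  ultimately show "C1 p" by simp
qed

lemma vec_polys_C1: "p \<in> vec_polys j \<Longrightarrow> C1_vec p"
  unfolding vec_polys_def C1_vec_def using polys_C1 by blast

lemma RT_C1: "p \<in> RT k \<Longrightarrow> C1_vec p"
proof -
  assume "p \<in> RT k"
  then obtain a q where a: "\<And>i. (\<lambda>x. a x $ i) \<in> polys k" and q: "q \<in> polys k"
    and p: "p = (\<lambda>x. a x + q x *\<^sub>R x)"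
    unfolding RT_def vec_polys_def by blast
  have "C1 (\<lambda>x. a x $ i + q x * x $ i)" for i
    by (intro C1_add C1_mult C1_component polys_C1[OF a] polys_C1[OF q])
  then show "C1_vec p" by (simp add: C1_vec_def p)
qed

lemma C1_vec_component: "C1_vec p \<Longrightarrow> C1 (\<lambda>x. p x $ i)"
  by (simp add: C1_vec_def)


lemma C1_vec_continuous:
  assumes "C1_vec p"
  shows "continuous_on S p"
proof -
  have "continuous_on S (\<lambda>x. \<chi> i. p x $ i)"
    by (intro continuous_intros C1_continuous C1_vec_component assms)
  then show ?thesis by simp
qed

lemma partial_continuous:
  assumes "C1 f"
  shows "continuous_on S (partial i f)"
  unfolding partial_def[abs_def] by (rule C1_derivative_continuous[OF assms])

lemma divg_continuous: "C1_vec p \<Longrightarrow> continuous_on S (divg p)"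
  unfolding divg_def[abs_def]
  by (intro continuous_intros partial_continuous C1_vec_component)

lemma advect_continuous: "C1_vec p \<Longrightarrow> continuous_on S (advect p p)"
  unfolding advect_def[abs_def]
  by (intro continuous_intros partial_continuous C1_continuous C1_vec_component)

text \<open>
  The volume density of the convective form is half the divergence of \<open>\<bar>p\<bar>\<^sup>2 p\<close>; this is the purpose of
  the factor 1/2 in front of its divergence term.
\<close>

lemma divergence_cubic:
  fixes p :: "real^'n::finite \<Rightarrow> real^'n"
  assumes p: "C1_vec p"
  shows "(\<Sum>i\<in>UNIV. partial i (\<lambda>y. (p y \<bullet> p y) * p y $ i) x)
       = 2 * (advect p p x \<bullet> p x) + divg p x * (p x \<bullet> p x)"
proof -
  note c = C1_vec_component[OF p]
  have sq: "(\<lambda>y. p y \<bullet> p y) = (\<lambda>y. \<Sum>j\<in>UNIV. p y $ j * p y $ j)"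
    by (simp add: inner_vec_def)
  have C1sq: "C1 (\<lambda>y. p y \<bullet> p y)" unfolding sq by (intro C1_sum C1_mult c)
  have dsq: "partial i (\<lambda>y. p y \<bullet> p y) x = (\<Sum>j\<in>UNIV. 2 * (p x $ j * partial i (\<lambda>y. p y $ j) x))" for i
    unfolding sq partial_def
    by (subst frechet_derivative_sum)
       (auto simp: frechet_derivative_mult c C1_mult mult.commute intro!: sum.cong)
  have "(\<Sum>i\<in>UNIV. partial i (\<lambda>y. (p y \<bullet> p y) * p y $ i) x)
      = (\<Sum>i\<in>UNIV. (p x \<bullet> p x) * partial i (\<lambda>y. p y $ i) x + partial i (\<lambda>y. p y \<bullet> p y) x * p x $ i)"
    by (simp add: partial_def frechet_derivative_mult[OF C1sq c])
  also have "\<dots> = divg p x * (p x \<bullet> p x) + (\<Sum>i\<in>UNIV. partial i (\<lambda>y. p y \<bullet> p y) x * p x $ i)"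
    unfolding divg_def sum.distrib sum_distrib_right by (simp only: mult.commute)
  also have "(\<Sum>i\<in>UNIV. partial i (\<lambda>y. p y \<bullet> p y) x * p x $ i)
      = (\<Sum>i\<in>UNIV. \<Sum>j\<in>UNIV. 2 * (p x $ i * partial i (\<lambda>y. p y $ j) x * p x $ j))"
    unfolding dsq sum_distrib_right by (intro sum.cong refl) (simp only: mult_ac)
  also have "\<dots> = (\<Sum>j\<in>UNIV. \<Sum>i\<in>UNIV. 2 * (p x $ i * partial i (\<lambda>y. p y $ j) x * p x $ j))"
    by (rule sum.swap)
  also have "\<dots> = 2 * (advect p p x \<bullet> p x)"
    by (simp add: advect_def inner_vec_def sum_distrib_left sum_distrib_right)
  finally show ?thesis by linarith
qed

lemma C1_cubic: "C1_vec p \<Longrightarrow> C1 (\<lambda>y. (p y \<bullet> p y) * p y $ i)"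
  unfolding inner_vec_def inner_real_def by (intro C1_mult C1_sum C1_vec_component)

text \<open>
  A piecewise function is known on the open elements only, and its pointwise derivatives there are
  those of the local representative.
\<close>

lemma partial_eq_on_open:
  assumes f: "C1 f" and S: "open S" "x \<in> S" and eq: "\<And>y. y \<in> S \<Longrightarrow> g y = f y"
  shows "partial i g x = partial i f x"
proof -
  have "(g has_derivative frechet_derivative f (at x)) (at x)"
    using has_derivative_transform_within_open[OF C1_has_derivative[OF f] S] eq by metis
  from frechet_derivative_at[OF this] show ?thesis by (simp add: partial_def)
qed

lemma divg_advect_eq_on_open:
  assumes p: "C1_vec p" and S: "open S" "x \<in> S" and eq: "\<And>y. y \<in> S \<Longrightarrow> w y = p y"
  shows "divg w x = divg p x" and "advect w w x = advect p p x"
proof -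
  have "partial i (\<lambda>y. w y $ j) x = partial i (\<lambda>y. p y $ j) x" for i j
    by (rule partial_eq_on_open[OF C1_vec_component[OF p] S]) (simp add: eq)
  then show "divg w x = divg p x" "advect w w x = advect p p x"
    by (simp_all add: divg_def advect_def eq[OF S(2)])
qed

text \<open>
  Every point of a closed element is a limit of its interior, so the limit that defines the trace
  is not over a trivial filter and picks the value of the continuous representative.
\<close>

lemma trace_eq:
  fixes K :: "(real^'n::finite) set" and \<phi> :: "real^'n \<Rightarrow> 'b::real_normed_vector"
  assumes K: "closure (interior K) = K" "x \<in> K"
    and p: "continuous_on UNIV p" and eq: "\<And>y. y \<in> interior K \<Longrightarrow> \<phi> y = p y"
  shows "trace K \<phi> x = p x"
proof -
  have "x islimpt interior K"
  proof (cases "x \<in> interior K")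
    case True
    then show ?thesis by (intro interior_limit_point) simp
  next
    case False
    then show ?thesis using K by (metis closure_def UnE mem_Collect_eq)
  qed
  then have "at x within interior K \<noteq> bot" by (simp add: trivial_limit_within)
  moreover have "(\<phi> \<longlongrightarrow> p x) (at x within interior K)"
  proof -
    have "(p \<longlongrightarrow> p x) (at x within interior K)"
      using p by (meson UNIV_I continuous_on_def tendsto_within_subset subset_UNIV)
    then show ?thesis
      by (rule Lim_transform_within[OF _ zero_less_one]) (simp add: eq)
  qed
  ultimately show ?thesis unfolding trace_def by (rule tendsto_Lim)
qed

lemma face_integral_cong:
  assumes "\<And>x. x \<in> F \<Longrightarrow> f x = g x"
  shows "face_integral F f = face_integral F g"
  unfolding face_integral_def set_lebesgue_integral_def
  by (rule Bochner_Integration.integral_cong) (simp_all add: indicator_def assms)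

lemma face_inner_eq: "face_inner F f g = face_integral F (\<lambda>x. f x \<bullet> g x)"
  by (simp add: face_inner_def face_integral_def)

lemma face_integral_nonneg:
  assumes "\<And>x. x \<in> F \<Longrightarrow> 0 \<le> f x"
  shows "0 \<le> face_integral F f"
  unfolding face_integral_def set_lebesgue_integral_def
  by (rule Bochner_Integration.integral_nonneg) (simp add: indicator_def assms)

lemma mesh_facet_integrable:
  fixes M :: "'n::finite mesh" and g :: "real^'n \<Rightarrow> real"
  assumes M: "conforming_mesh M" and K: "K \<in> cells M" and F: "F facet_of K"
    and n: "outer_unit_normal K F n" and g: "continuous_on F g"
  shows "set_integrable (surface_measure (affine hull F)) F g"
proof -
  obtain c where c: "affine hull F = {x. n \<bullet> x = c}"
    by (rule facet_hyperplane[OF mesh_cell(4)[OF M K] F n])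
  have comp: "compact F"
    using face_of_imp_compact[OF mesh_cell(2,3)[OF M K] facet_of_imp_face_of[OF F]] .
  have "norm n = 1" using n by (simp add: outer_unit_normal_def)
  from face_integral_prism(4)[OF this comp c g] show ?thesis by simp
qed

section \<open>Energy balance of the convective terms\<close>

lemma face_integral_linear:
  assumes "set_integrable (surface_measure (affine hull F)) F f"
    and "set_integrable (surface_measure (affine hull F)) F g"
  shows "face_integral F (\<lambda>x. a * f x + b * g x) = a * face_integral F f + b * face_integral F g"
  using assms unfolding face_integral_def
  by (subst set_integral_add(2)) (auto intro!: set_integrable_mult_right)

lemma set_integral_sum_real:
  fixes f :: "'i \<Rightarrow> 'a \<Rightarrow> real"
  assumes "\<And>i. i \<in> I \<Longrightarrow> set_integrable \<mu> A (f i)"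
  shows "(LINT x:A|\<mu>. \<Sum>i\<in>I. f i x) = (\<Sum>i\<in>I. LINT x:A|\<mu>. f i x)"
  using assms unfolding set_lebesgue_integral_def set_integrable_def scaleR_sum_right
  by (rule Bochner_Integration.integral_sum)

text \<open>
  Each component of \<open>\<bar>p\<bar>\<^sup>2 p\<close> is differentiated in its own coordinate direction, and the components of the
  normal reassemble the flux.
\<close>

lemma divergence_theorem_cubic:
  fixes K :: "(real^'n::finite) set"
  assumes K: "int DIM(real^'n) simplex K" and p: "C1_vec p"
    and \<nu>: "\<And>F. F facet_of K \<Longrightarrow> outer_unit_normal K F (\<nu> F)"
    and int: "\<And>F g. F facet_of K \<Longrightarrow> continuous_on F g \<Longrightarrow>
      set_integrable (surface_measure (affine hull F)) F (g :: real^'n \<Rightarrow> real)"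
  shows "(LINT x:K|lborel. advect p p x \<bullet> p x + (1/2) * (divg p x * (p x \<bullet> p x)))
       = (\<Sum>F | F facet_of K. 1/2 * face_integral F (\<lambda>x. (p x \<bullet> p x) * (p x \<bullet> \<nu> F)))"
proof -
  define q where "q i = (\<lambda>y. (p y \<bullet> p y) * p y $ i)" for i
  have q: "C1 (q i)" for i unfolding q_def by (rule C1_cubic[OF p])
  have comp: "compact K" by (rule compact_simplex[OF K])
  have int_vol: "set_integrable lborel K (partial i (q i))" for i
    using borel_integrable_compact[OF comp partial_continuous[OF q]]
    by (simp add: set_integrable_def)
  have flux: "(\<Sum>i\<in>UNIV. \<nu> F $ i * face_integral F (q i))
      = face_integral F (\<lambda>x. (p x \<bullet> p x) * (p x \<bullet> \<nu> F))" if F: "F facet_of K" for F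
  proof -
    have "(\<Sum>i\<in>UNIV. \<nu> F $ i * face_integral F (q i))
        = (\<Sum>i\<in>UNIV. face_integral F (\<lambda>x. \<nu> F $ i * q i x))"
      unfolding face_integral_def by simp
    also have "\<dots> = face_integral F (\<lambda>x. \<Sum>i\<in>UNIV. \<nu> F $ i * q i x)"
      unfolding face_integral_def
      by (rule set_integral_sum_real[symmetric]) (intro int[OF F] continuous_intros C1_continuous q)
    also have "(\<lambda>x. \<Sum>i\<in>UNIV. \<nu> F $ i * q i x) = (\<lambda>x. (p x \<bullet> p x) * (p x \<bullet> \<nu> F))"
      unfolding q_def inner_vec_def[of "p _" "\<nu> F"] sum_distrib_left inner_real_def
      by (intro ext sum.cong refl) (simp only: mult_ac)
    finally show ?thesis .
  qed
  have "(LINT x:K|lborel. advect p p x \<bullet> p x + (1/2) * (divg p x * (p x \<bullet> p x)))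
      = (LINT x:K|lborel. 1/2 * (\<Sum>i\<in>UNIV. partial i (q i) x))"
    unfolding q_def divergence_cubic[OF p] by (simp add: field_simps)
  also have "\<dots> = 1/2 * (\<Sum>i\<in>UNIV. (LINT x:K|lborel. partial i (q i) x))"
    by (subst set_integral_sum_real[symmetric]) (auto intro: int_vol)
  also have "\<dots> = 1/2 * (\<Sum>i\<in>UNIV. \<Sum>F | F facet_of K. \<nu> F $ i * face_integral F (q i))"
    using divergence_theorem_simplex[OF K \<nu> q]
    by (simp add: partial_def inner_axis)
  also have "\<dots> = 1/2 * (\<Sum>F | F facet_of K. face_integral F (\<lambda>x. (p x \<bullet> p x) * (p x \<bullet> \<nu> F)))"
    by (subst sum.swap) (simp add: flux)
  finally show ?thesis by (simp add: sum_distrib_left)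
qed

text \<open>
  This is the identity \<open>(\<bar>a\<bar>\<^sup>2 a - \<bar>b\<bar>\<^sup>2 b) \<bullet> n = {a} \<bullet> n (\<bar>a\<bar>\<^sup>2 - \<bar>b\<bar>\<^sup>2) + (a - b) \<bullet> n {\<bar>a\<bar>\<^sup>2}\<close>, braces
  denoting averages, together with \<open>\<bar>a\<bar>\<^sup>2 - \<bar>b\<bar>\<^sup>2 = 2 (a - b) \<bullet> {a}\<close>. The shape of the two sides is that
  of the flux sum and of the face terms in \<open>convection_energy_balance\<close>.
\<close>

lemma face_jump_identity:
  fixes a b n :: "'a::real_inner"
  shows "1/2 * ((a \<bullet> a) * (a \<bullet> n)) + 1/2 * ((b \<bullet> b) * (b \<bullet> - n))
    = 1 * ((((1/2) *\<^sub>R (a + b) \<bullet> n) *\<^sub>R (a - b)) \<bullet> ((1/2) *\<^sub>R (a + b)))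
      + 1/2 * (((a - b) \<bullet> n) \<bullet> ((1/2) *\<^sub>R (a \<bullet> a + b \<bullet> b)))"
proof -
  have "(a - b) \<bullet> (a + b) = a \<bullet> a - b \<bullet> b"
    by (simp add: inner_add_right inner_diff_left inner_commute[of b a])
  then show ?thesis
    by (simp add: inner_add_left inner_diff_left algebra_simps)
       (simp add: inner_commute field_simps)
qed

text \<open>
  The outward normal of the element, expressed by the fixed normal of the face; it is meant for the
  one or two elements at the face.
\<close>

definition cell_normal :: "'n::finite mesh \<Rightarrow> (real^'n) set \<Rightarrow> (real^'n) set \<Rightarrow> real^'n" where
  "cell_normal M K F = (if K = Kplus M F then normal M F else - normal M F)"

lemma mesh_cells_of_interior_face:
  fixes M :: "'n::finite mesh"
  assumes M: "conforming_mesh M" and F: "F \<in> interior_faces M"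
  shows "{K \<in> cells M. F facet_of K} = {Kplus M F, Kminus M F}"
proof -
  note D = conforming_meshD(8)[OF M F]
  have "K = Kplus M F \<or> K = Kminus M F" if "K \<in> cells M" "F facet_of K" for K
    by (rule mesh_at_most_two_cells[OF M _ _ _ that(1) _ _ that(2), where n = "normal M F"]) (use D in simp_all)
  then show ?thesis using D by blast
qed

lemma mesh_cells_of_outer_face:
  fixes M :: "'n::finite mesh"
  assumes M: "conforming_mesh M" and F: "F \<in> faces M" "F \<notin> interior_faces M"
  shows "{K \<in> cells M. F facet_of K} = {Kplus M F}"
  using conforming_meshD(9)[OF M mesh_face_boundary[OF M F]] F(2)
  unfolding interior_faces_def by blast

lemma mesh_cell_normal:
  fixes M :: "'n::finite mesh"
  assumes M: "conforming_mesh M" and K: "K \<in> cells M" and F: "F facet_of K"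
  shows "outer_unit_normal K F (cell_normal M K F)"
proof (cases "F \<in> interior_faces M")
  case True
  note D = conforming_meshD(8)[OF M True]
  show ?thesis
  proof (cases "K = Kplus M F")
    case True
    then show ?thesis using D by (simp add: cell_normal_def)
  next
    case False
    then show ?thesis
      using mesh_opposite_normal[OF M _ K _ _ F, of "Kplus M F" "normal M F"] D
      by (simp add: cell_normal_def)
  qed
next
  case False
  have FF: "F \<in> faces M" using K F by (auto simp: faces_def)
  have "K = Kplus M F" using mesh_cells_of_outer_face[OF M FF False] K F by blast
  then show ?thesis
    using conforming_meshD(9)[OF M mesh_face_boundary[OF M FF False]] by (simp add: cell_normal_def)
qed

lemma mesh_faces_finite:
  fixes M :: "'n::finite mesh"
  assumes M: "conforming_mesh M"
  shows "finite (faces M)"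
proof -
  have "faces M = (\<Union>K\<in>cells M. {F. F facet_of K})" by (auto simp: faces_def)
  then show ?thesis using conforming_meshD(4)[OF M] mesh_cell(7)[OF M] by simp
qed

lemma interior_faces_subset: "interior_faces M \<subseteq> faces M"
  by (auto simp: interior_faces_def faces_def)

text \<open>
  Summation over elements and their facets is rearranged as a summation over faces, where an interior
  face is met from both sides and any other face once.
\<close>

lemma sum_cells_facets:
  fixes M :: "'n::finite mesh" and h :: "(real^'n) set \<Rightarrow> (real^'n) set \<Rightarrow> real"
  assumes M: "conforming_mesh M"
  shows "(\<Sum>K\<in>cells M. \<Sum>F | F facet_of K. h K F)
      = (\<Sum>F\<in>interior_faces M. h (Kplus M F) F + h (Kminus M F) F)
        + (\<Sum>F\<in>faces M - interior_faces M. h (Kplus M F) F)"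
proof -
  note fin = mesh_faces_finite[OF M]
  have "(\<Sum>K\<in>cells M. \<Sum>F | F facet_of K. h K F)
      = (\<Sum>K\<in>cells M. \<Sum>F\<in>{F\<in>faces M. F facet_of K}. h K F)"
    by (intro sum.cong refl) (auto simp: faces_def)
  also have "\<dots> = (\<Sum>F\<in>faces M. \<Sum>K\<in>{K\<in>cells M. F facet_of K}. h K F)"
    by (rule sum.swap_restrict[OF conforming_meshD(4)[OF M] fin])
  also have "\<dots> = (\<Sum>F\<in>interior_faces M. \<Sum>K\<in>{K\<in>cells M. F facet_of K}. h K F)
      + (\<Sum>F\<in>faces M - interior_faces M. \<Sum>K\<in>{K\<in>cells M. F facet_of K}. h K F)"
    by (subst sum.subset_diff[OF interior_faces_subset fin]) simp
  also have "(\<Sum>F\<in>interior_faces M. \<Sum>K\<in>{K\<in>cells M. F facet_of K}. h K F)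
      = (\<Sum>F\<in>interior_faces M. h (Kplus M F) F + h (Kminus M F) F)"
  proof (rule sum.cong[OF refl])
    fix F assume F: "F \<in> interior_faces M"
    show "(\<Sum>K\<in>{K\<in>cells M. F facet_of K}. h K F) = h (Kplus M F) F + h (Kminus M F) F"
      unfolding mesh_cells_of_interior_face[OF M F]
      using conforming_meshD(8)[OF M F] by simp
  qed
  also have "(\<Sum>F\<in>faces M - interior_faces M. \<Sum>K\<in>{K\<in>cells M. F facet_of K}. h K F)
      = (\<Sum>F\<in>faces M - interior_faces M. h (Kplus M F) F)"
  proof (rule sum.cong[OF refl])
    fix F assume F: "F \<in> faces M - interior_faces M"
    show "(\<Sum>K\<in>{K\<in>cells M. F facet_of K}. h K F) = h (Kplus M F) F"
      using mesh_cells_of_outer_face[OF M, of F] F by simp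
  qed
  finally show ?thesis .
qed

text \<open>
  The local representatives \<open>P K\<close> make the fluxes through the facets accessible. The last sum
  is the flux of kinetic energy through the boundary of the domain.
\<close>

lemma convection_energy_balance:
  fixes M :: "'n::finite mesh" and w :: "real^'n \<Rightarrow> real^'n"
  assumes M: "conforming_mesh M"
    and P: "\<And>K. K \<in> cells M \<Longrightarrow> C1_vec (P K)"
    and wP: "\<And>K x. K \<in> cells M \<Longrightarrow> x \<in> interior K \<Longrightarrow> w x = P K x"
  shows "L2_inner (region M) (advect w w) w + 1/2 * L2_inner (region M) (\<lambda>x. divg w x *\<^sub>R w x) w
     = (\<Sum>F\<in>interior_faces M.
          face_inner F (\<lambda>x. (avg M F w x \<bullet> normal M F) *\<^sub>R jump M F w x) (avg M F w))
     + 1/2 * (\<Sum>F\<in>interior_faces M.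
          face_inner F (\<lambda>x. jump M F w x \<bullet> normal M F) (avg M F (\<lambda>x. w x \<bullet> w x)))
     + (\<Sum>F\<in>faces M - interior_faces M.
          1/2 * face_integral F (\<lambda>x. (P (Kplus M F) x \<bullet> P (Kplus M F) x) * (P (Kplus M F) x \<bullet> normal M F)))"
proof -
  note Pc = C1_vec_continuous[OF P]
  define \<nu> where "\<nu> = cell_normal M"
  have \<nu>: "outer_unit_normal K F (\<nu> K F)" if "K \<in> cells M" "F facet_of K" for K F
    unfolding \<nu>_def by (rule mesh_cell_normal[OF M that])
  have tr: "trace K w x = P K x" "trace K (\<lambda>x. w x \<bullet> w x) x = P K x \<bullet> P K x"
    if K: "K \<in> cells M" and x: "x \<in> K" for K x
    using wP[OF K] by (auto intro!: trace_eq[OF mesh_cell(6)[OF M K] x] continuous_intros Pc[OF K])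
  define h where "h K F = 1/2 * face_integral F (\<lambda>x. (P K x \<bullet> P K x) * (P K x \<bullet> \<nu> K F))" for K F
  have eqs: "divg w x = divg (P K) x" "advect w w x = advect (P K) (P K) x"
    if "K \<in> cells M" "x \<in> interior K" for K x
    using divg_advect_eq_on_open[OF P[OF that(1)] open_interior that(2), of w] wP[OF that(1)] by auto
  have I1: "integrable (lebesgue_on (region M)) (\<lambda>x. advect w w x \<bullet> w x)"
    by (rule integral_region_sum_cells(1)[OF M, of _ "\<lambda>K x. advect (P K) (P K) x \<bullet> P K x"])
       (simp_all add: eqs wP continuous_on_inner advect_continuous P Pc)
  have I2: "integrable (lebesgue_on (region M)) (\<lambda>x. (divg w x *\<^sub>R w x) \<bullet> w x)"
    by (rule integral_region_sum_cells(1)[OF M, of _ "\<lambda>K x. (divg (P K) x *\<^sub>R P K x) \<bullet> P K x"])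
       (simp_all add: eqs wP continuous_on_inner continuous_on_mult divg_continuous P Pc)
  have "L2_inner (region M) (advect w w) w + 1/2 * L2_inner (region M) (\<lambda>x. divg w x *\<^sub>R w x) w
      = (LINT x|lebesgue_on (region M). advect w w x \<bullet> w x + (1/2) * ((divg w x *\<^sub>R w x) \<bullet> w x))"
    unfolding L2_inner_def using I1 I2 by simp
  also have "\<dots> = (\<Sum>K\<in>cells M. LINT x:K|lborel. advect (P K) (P K) x \<bullet> P K x
      + (1/2) * (divg (P K) x * (P K x \<bullet> P K x)))"
  proof (rule integral_region_sum_cells(2)[OF M])
    show "continuous_on K (\<lambda>x. advect (P K) (P K) x \<bullet> P K x + (1/2) * (divg (P K) x * (P K x \<bullet> P K x)))"
      if "K \<in> cells M" for K
      by (intro continuous_intros advect_continuous divg_continuous P[OF that] Pc[OF that])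
  qed (simp add: eqs wP)
  also have "\<dots> = (\<Sum>K\<in>cells M. \<Sum>F | F facet_of K. h K F)"
    unfolding h_def
    by (intro sum.cong refl divergence_theorem_cubic mesh_cell(1)[OF M] P \<nu>)
       (auto intro: mesh_facet_integrable[OF M _ _ \<nu>])
  also have "\<dots> = (\<Sum>F\<in>interior_faces M. h (Kplus M F) F + h (Kminus M F) F)
        + (\<Sum>F\<in>faces M - interior_faces M. h (Kplus M F) F)"
    by (rule sum_cells_facets[OF M])
  also have "(\<Sum>F\<in>interior_faces M. h (Kplus M F) F + h (Kminus M F) F)
      = (\<Sum>F\<in>interior_faces M.
          face_inner F (\<lambda>x. (avg M F w x \<bullet> normal M F) *\<^sub>R jump M F w x) (avg M F w)
          + 1/2 * face_inner F (\<lambda>x. jump M F w x \<bullet> normal M F) (avg M F (\<lambda>x. w x \<bullet> w x)))"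
  proof (rule sum.cong[OF refl])
    fix F assume F: "F \<in> interior_faces M"
    note D = conforming_meshD(8)[OF M F]
    define n where "n = normal M F"
    define a where "a = P (Kplus M F)"
    define b where "b = P (Kminus M F)"
    have ca: "continuous_on F a" and cb: "continuous_on F b"
      using D Pc by (auto simp: a_def b_def)
    have \<nu>F: "\<nu> (Kplus M F) F = n" "\<nu> (Kminus M F) F = - n"
      using D by (auto simp: \<nu>_def cell_normal_def n_def)
    have t: "trace (Kplus M F) w x = a x" "trace (Kminus M F) w x = b x"
        "trace (Kplus M F) (\<lambda>x. w x \<bullet> w x) x = a x \<bullet> a x" "trace (Kminus M F) (\<lambda>x. w x \<bullet> w x) x = b x \<bullet> b x"
      if "x \<in> F" for x
    proof -
      have "x \<in> Kplus M F" "x \<in> Kminus M F" using D that facet_of_imp_subset by blast+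
      then show "trace (Kplus M F) w x = a x" "trace (Kminus M F) w x = b x"
        "trace (Kplus M F) (\<lambda>x. w x \<bullet> w x) x = a x \<bullet> a x" "trace (Kminus M F) (\<lambda>x. w x \<bullet> w x) x = b x \<bullet> b x"
        using D by (simp_all add: tr a_def b_def)
    qed
    have int: "set_integrable (surface_measure (affine hull F)) F g" if "continuous_on F g" for g :: "real^'n \<Rightarrow> real"
      using mesh_facet_integrable[OF M _ _ _ that, of "Kplus M F"] D by blast
    define f1 where "f1 x = ((1/2) *\<^sub>R (a x + b x) \<bullet> n) *\<^sub>R (a x - b x) \<bullet> ((1/2) *\<^sub>R (a x + b x))" for x
    define f2 where "f2 x = ((a x - b x) \<bullet> n) \<bullet> ((1/2) *\<^sub>R (a x \<bullet> a x + b x \<bullet> b x))" for x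
    have "h (Kplus M F) F + h (Kminus M F) F
        = face_integral F (\<lambda>x. 1/2 * ((a x \<bullet> a x) * (a x \<bullet> n)) + 1/2 * ((b x \<bullet> b x) * (b x \<bullet> - n)))"
      unfolding h_def \<nu>F a_def[symmetric] b_def[symmetric]
      by (rule face_integral_linear[symmetric]) (intro int continuous_intros ca cb)+
    also have "\<dots> = face_integral F (\<lambda>x. 1 * f1 x + 1/2 * f2 x)"
      unfolding f1_def f2_def by (intro face_integral_cong face_jump_identity)
    also have "\<dots> = 1 * face_integral F f1 + 1/2 * face_integral F f2"
      by (rule face_integral_linear; rule int; unfold f1_def f2_def; intro continuous_intros ca cb)
    also have "face_integral F f1
        = face_inner F (\<lambda>x. (avg M F w x \<bullet> normal M F) *\<^sub>R jump M F w x) (avg M F w)"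
      unfolding face_inner_eq using F
      by (intro face_integral_cong) (simp add: f1_def avg_def jump_def t n_def)
    also have "face_integral F f2
        = face_inner F (\<lambda>x. jump M F w x \<bullet> normal M F) (avg M F (\<lambda>x. w x \<bullet> w x))"
      unfolding face_inner_eq using F
      by (intro face_integral_cong) (simp add: f2_def avg_def jump_def t n_def)
    finally show "h (Kplus M F) F + h (Kminus M F) F =
          face_inner F (\<lambda>x. (avg M F w x \<bullet> normal M F) *\<^sub>R jump M F w x) (avg M F w)
          + 1/2 * face_inner F (\<lambda>x. jump M F w x \<bullet> normal M F) (avg M F (\<lambda>x. w x \<bullet> w x))"
      by simp
  qed
  finally show ?thesis
    by (simp add: h_def \<nu>_def cell_normal_def sum.distrib sum_distrib_left)
qed

text \<open>
  The hypothesis on the boundary faces covers both cases of the theorem: either the penalty is strong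
  enough to absorb the boundary flux, or there is no boundary flux.
\<close>

theorem convection_nonneg:
  fixes M :: "'n::finite mesh" and w :: "real^'n \<Rightarrow> real^'n"
  assumes M: "conforming_mesh M" and w: "w \<in> piecewise M S" and S: "\<And>p. p \<in> S \<Longrightarrow> C1_vec p"
    and \<theta>: "\<theta> \<le> 1" and \<zeta>: "\<And>F. F \<in> faces M \<Longrightarrow> \<zeta> F \<ge> 0"
    and bd: "\<And>F. F \<in> boundary_faces M \<Longrightarrow> \<zeta> F \<ge> 1/2 * \<bar>1 - \<theta>\<bar> \<or>
      (\<forall>x\<in>F. trace (Kplus M F) w x \<bullet> normal M F = 0)"
  shows "0 \<le> c1_form M \<zeta> \<theta> w w" and "0 \<le> c2_form M \<zeta> \<theta> w w"
proof -
  have "\<forall>K\<in>cells M. \<exists>p\<in>S. \<forall>x\<in>interior K. w x = p x"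
    using w by (simp add: piecewise_def)
  then obtain P where P: "\<And>K. K \<in> cells M \<Longrightarrow> C1_vec (P K)"
    and wP: "\<And>K x. K \<in> cells M \<Longrightarrow> x \<in> interior K \<Longrightarrow> w x = P K x"
    using S by metis
  define pen where "pen F = face_inner F (\<lambda>x. (\<zeta> F * \<bar>avg M F w x \<bullet> normal M F\<bar>) *\<^sub>R jump M F w x) (jump M F w)" for F
  define flux where "flux F = 1/2 * face_integral F (\<lambda>x. (P (Kplus M F) x \<bullet> P (Kplus M F) x) * (P (Kplus M F) x \<bullet> normal M F))" for F
  let ?outer = "faces M - interior_faces M"
  have pen0: "0 \<le> pen F" if "F \<in> faces M" for F
    unfolding pen_def face_inner_eq by (rule face_integral_nonneg) (simp add: \<zeta>[OF that])
  have outer: "0 \<le> (1 - \<theta>) * flux F + pen F" if F: "F \<in> ?outer" for F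
  proof -
    have FF: "F \<in> faces M" "F \<notin> interior_faces M" using F by auto
    note Fb = mesh_face_boundary[OF M FF]
    note D = conforming_meshD(9)[OF M Fb]
    define p where "p = P (Kplus M F)"
    define n where "n = normal M F"
    have cp: "continuous_on F p" unfolding p_def using D C1_vec_continuous P by blast
    have t: "trace (Kplus M F) w x = p x" if "x \<in> F" for x
    proof -
      have "x \<in> Kplus M F" using D that facet_of_imp_subset by blast
      then show ?thesis
        unfolding p_def using D wP
        by (intro trace_eq[OF mesh_cell(6)[OF M]] C1_vec_continuous P) auto
    qed
    have int: "set_integrable (surface_measure (affine hull F)) F g" if "continuous_on F g" for g :: "real^'n \<Rightarrow> real"
      using mesh_facet_integrable[OF M _ _ _ that, of "Kplus M F"] D by blast
    have pen: "pen F = face_integral F (\<lambda>x. \<zeta> F * (\<bar>p x \<bullet> n\<bar> * (p x \<bullet> p x)))"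
      unfolding pen_def face_inner_eq using FF(2)
      by (intro face_integral_cong) (simp add: avg_def jump_def t n_def)
    have "(1 - \<theta>) * flux F + pen F
        = (1 - \<theta>) / 2 * face_integral F (\<lambda>x. (p x \<bullet> p x) * (p x \<bullet> n))
          + \<zeta> F * face_integral F (\<lambda>x. \<bar>p x \<bullet> n\<bar> * (p x \<bullet> p x))"
      unfolding pen flux_def p_def[symmetric] n_def[symmetric] by (simp add: face_integral_def)
    also have "\<dots> = face_integral F (\<lambda>x. (1 - \<theta>) / 2 * ((p x \<bullet> p x) * (p x \<bullet> n))
          + \<zeta> F * (\<bar>p x \<bullet> n\<bar> * (p x \<bullet> p x)))"
      by (rule face_integral_linear[symmetric]; rule int; intro continuous_intros cp)
    also have "\<dots> \<ge> 0"
    proof (rule face_integral_nonneg)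
      fix x assume x: "x \<in> F"
      have "0 \<le> (1 - \<theta>) / 2 * (p x \<bullet> n) + \<zeta> F * \<bar>p x \<bullet> n\<bar>"
      proof (cases "p x \<bullet> n = 0")
        case False
        then have "(1 - \<theta>) / 2 \<le> \<zeta> F" using bd[OF Fb] x t \<theta> by (auto simp: n_def)
        then have "(1 - \<theta>) / 2 * \<bar>p x \<bullet> n\<bar> \<le> \<zeta> F * \<bar>p x \<bullet> n\<bar>" by (rule mult_right_mono) simp
        moreover have "(1 - \<theta>) / 2 * (- (p x \<bullet> n)) \<le> (1 - \<theta>) / 2 * \<bar>p x \<bullet> n\<bar>"
          using \<theta> by (intro mult_left_mono) auto
        ultimately show ?thesis by simp
      qed simp
      then have "0 \<le> ((1 - \<theta>) / 2 * (p x \<bullet> n) + \<zeta> F * \<bar>p x \<bullet> n\<bar>) * (p x \<bullet> p x)"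
        by (rule mult_nonneg_nonneg) simp
      then show "0 \<le> (1 - \<theta>) / 2 * ((p x \<bullet> p x) * (p x \<bullet> n)) + \<zeta> F * (\<bar>p x \<bullet> n\<bar> * (p x \<bullet> p x))"
        by (simp add: algebra_simps)
    qed
    finally show ?thesis .
  qed
  have "(\<Sum>F\<in>faces M. pen F) = (\<Sum>F\<in>interior_faces M. pen F) + (\<Sum>F\<in>?outer. pen F)"
    by (subst sum.subset_diff[OF interior_faces_subset mesh_faces_finite[OF M]]) simp
  moreover have "0 \<le> (\<Sum>F\<in>interior_faces M. pen F)"
    using interior_faces_subset pen0 by (intro sum_nonneg) blast
  moreover have "0 \<le> (\<Sum>F\<in>?outer. (1 - \<theta>) * flux F + pen F)"
    by (intro sum_nonneg outer)
  ultimately have main: "0 \<le> (1 - \<theta>) * (\<Sum>F\<in>?outer. flux F) + (\<Sum>F\<in>faces M. pen F)"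
    by (simp add: sum.distrib sum_distrib_left)
  define A where "A = L2_inner (region M) (advect w w) w"
  define B where "B = L2_inner (region M) (\<lambda>x. divg w x *\<^sub>R w x) w"
  define C where "C = (\<Sum>F\<in>interior_faces M.
          face_inner F (\<lambda>x. (avg M F w x \<bullet> normal M F) *\<^sub>R jump M F w x) (avg M F w))"
  define D where "D = (\<Sum>F\<in>interior_faces M.
          face_inner F (\<lambda>x. jump M F w x \<bullet> normal M F) (avg M F (\<lambda>x. w x \<bullet> w x)))"
  define E where "E = (\<Sum>F\<in>?outer. flux F)"
  define G where "G = (\<Sum>F\<in>faces M. pen F)"
  have bal: "A + 1/2 * B = C + 1/2 * D + E"
    unfolding A_def B_def C_def D_def E_def flux_def
    by (rule convection_energy_balance[OF M]) (use P wP in auto)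
  have m: "0 \<le> (1 - \<theta>) * E + G" using main by (simp add: E_def G_def)
  have "c1_form M \<zeta> \<theta> w w = A + 1/2 * B - C - 1/2 * D + G + \<theta> * C + \<theta>/2 * D - \<theta> * A - \<theta>/2 * B"
    by (simp only: c1_form_def A_def B_def C_def D_def G_def pen_def)
  also have "\<dots> = (1 - \<theta>) * ((A + 1/2 * B) - C - 1/2 * D) + G" by (simp add: field_simps)
  also have "\<dots> = (1 - \<theta>) * E + G" unfolding bal by simp
  finally show "0 \<le> c1_form M \<zeta> \<theta> w w" using m by simp
  have "c2_form M \<zeta> \<theta> w w = A + (1 - \<theta>)/2 * B - C - (1 - \<theta>)/2 * D + G + \<theta> * C - \<theta> * A"
    by (simp only: c2_form_def A_def B_def C_def D_def G_def pen_def)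
  also have "\<dots> = (1 - \<theta>) * ((A + 1/2 * B) - C - 1/2 * D) + G" by (simp add: field_simps)
  also have "\<dots> = (1 - \<theta>) * E + G" unfolding bal by simp
  finally show "0 \<le> c2_form M \<zeta> \<theta> w w" using m by simp
qed

lemma d_form_nonneg:
  fixes M :: "'n::finite mesh"
  assumes M: "conforming_mesh M" and "\<gamma> > 0"
  shows "0 \<le> d_form M \<gamma> w w"
proof -
  have "0 \<le> face_inner F f f" for F :: "(real^'n) set" and f :: "real^'n \<Rightarrow> real"
    unfolding face_inner_eq by (rule face_integral_nonneg) simp
  moreover have "0 \<le> diameter F" if F: "F \<in> faces M" for F
  proof -
    obtain K where K: "K \<in> cells M" "F facet_of K" using F by (auto simp: faces_def)
    then have "bounded F"
      using bounded_subset[OF compact_imp_bounded[OF mesh_cell(3)[OF M K(1)]] facet_of_imp_subset] by blast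
    then show ?thesis by (rule diameter_ge_0)
  qed
  moreover have "0 \<le> L2_inner (region M) (divg w) (divg w)"
    unfolding L2_inner_def by (rule Bochner_Integration.integral_nonneg) simp
  ultimately show ?thesis
    unfolding d_form_def using assms(2)
    by (intro mult_nonneg_nonneg add_nonneg_nonneg sum_nonneg) auto
qed

section \<open>Square integrable functions and midpoints in the discrete spaces\<close>

lemma L2_inner_integrable:
  fixes f g :: "real^'n::finite \<Rightarrow> 'b::euclidean_space"
  assumes "f \<in> L2 \<Omega>" "g \<in> L2 \<Omega>"
  shows "integrable (lebesgue_on \<Omega>) (\<lambda>x. f x \<bullet> g x)"
proof (rule Bochner_Integration.integrable_bound)
  show "integrable (lebesgue_on \<Omega>) (\<lambda>x. (norm (f x))\<^sup>2 + (norm (g x))\<^sup>2)"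
    using assms by (simp add: L2_def)
  show "(\<lambda>x. f x \<bullet> g x) \<in> borel_measurable (lebesgue_on \<Omega>)"
    using assms by (auto simp: L2_def)
  have "\<bar>f x \<bullet> g x\<bar> \<le> (norm (f x))\<^sup>2 + (norm (g x))\<^sup>2" for x
  proof -
    have "\<bar>f x \<bullet> g x\<bar> \<le> norm (f x) * norm (g x)" by (rule Cauchy_Schwarz_ineq2)
    also have "\<dots> \<le> (norm (f x))\<^sup>2 + (norm (g x))\<^sup>2"
      using sum_squares_bound[of "norm (f x)" "norm (g x)"] by (simp add: mult_nonneg_nonneg order_trans[rotated])
    finally show ?thesis .
  qed
  then show "AE x in lebesgue_on \<Omega>. norm (f x \<bullet> g x) \<le> norm ((norm (f x))\<^sup>2 + (norm (g x))\<^sup>2)"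
    by simp
qed

lemma L2_midpoint:
  fixes f g :: "real^'n::finite \<Rightarrow> 'b::euclidean_space"
  assumes f: "f \<in> L2 \<Omega>" and g: "g \<in> L2 \<Omega>"
  shows "(\<lambda>x. (1/2) *\<^sub>R (f x + g x)) \<in> L2 \<Omega>"
proof -
  have [measurable]: "f \<in> borel_measurable (lebesgue_on \<Omega>)" "g \<in> borel_measurable (lebesgue_on \<Omega>)"
    using assms by (auto simp: L2_def)
  have "(norm ((1/2) *\<^sub>R (f x + g x)))\<^sup>2 = 1/4 * (f x \<bullet> f x) + 1/2 * (f x \<bullet> g x) + 1/4 * (g x \<bullet> g x)" for x
    unfolding power2_norm_eq_inner by (simp add: inner_add_left inner_add_right inner_commute[of "g x" "f x"] add_divide_distrib)
  moreover have "integrable (lebesgue_on \<Omega>)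
      (\<lambda>x. 1/4 * (f x \<bullet> f x) + 1/2 * (f x \<bullet> g x) + 1/4 * (g x \<bullet> g x))"
    using L2_inner_integrable[OF f f] L2_inner_integrable[OF f g] L2_inner_integrable[OF g g] by simp
  ultimately show ?thesis by (simp add: L2_def)
qed

lemma L2_inner_midpoint:
  fixes f g h :: "real^'n::finite \<Rightarrow> 'b::euclidean_space"
  assumes "f \<in> L2 \<Omega>" "g \<in> L2 \<Omega>" "h \<in> L2 \<Omega>"
  shows "L2_inner \<Omega> (\<lambda>x. (1/2) *\<^sub>R (f x + g x)) h = 1/2 * (L2_inner \<Omega> f h + L2_inner \<Omega> g h)"
  using L2_inner_integrable[OF assms(1,3)] L2_inner_integrable[OF assms(2,3)]
  by (simp add: L2_inner_def inner_add_left)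

lemma continuous_L2:
  fixes f :: "real^'n::finite \<Rightarrow> 'b::euclidean_space"
  assumes \<Omega>: "open \<Omega>" "bounded \<Omega>" and f: "continuous_on UNIV f"
  shows "f \<in> L2 \<Omega>"
proof -
  have S: "\<Omega> \<in> lmeasurable" using \<Omega> by (simp add: lmeasurable_open)
  have m [measurable]: "f \<in> borel_measurable (lebesgue_on \<Omega>)"
    by (rule continuous_imp_measurable_on_sets_lebesgue)
       (use f continuous_on_subset S in auto)
  have "compact (f ` closure \<Omega>)"
    using \<Omega> f continuous_on_subset by (intro compact_continuous_image) auto
  then obtain B where B: "\<And>x. x \<in> closure \<Omega> \<Longrightarrow> norm (f x) \<le> B"
    using compact_imp_bounded by (fastforce simp: bounded_iff)
  have "finite_measure (lebesgue_on \<Omega>)" by (rule finite_measure_lebesgue_on[OF S])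
  then have "integrable (lebesgue_on \<Omega>) (\<lambda>x. (norm (f x))\<^sup>2)"
  proof (rule finite_measure.integrable_const_bound)
    show "AE x in lebesgue_on \<Omega>. norm ((norm (f x))\<^sup>2) \<le> B\<^sup>2"
      using B closure_subset[of \<Omega>] by (intro AE_I2) (auto intro!: power_mono)
  qed measurable
  then show ?thesis using m by (simp add: L2_def)
qed

text \<open>
  Needed to split the integrals in the definition of the weak divergence of a sum.
\<close>

lemma test_function_L2:
  fixes \<phi> :: "real^'n::finite \<Rightarrow> real"
  assumes \<Omega>: "open \<Omega>" "bounded \<Omega>" and \<phi>: "\<phi> \<in> test_functions \<Omega>"
  shows "\<phi> \<in> L2 \<Omega>" and "grad \<phi> \<in> L2 \<Omega>"
proof -
  have d: "foldr partial is \<phi> differentiable_on UNIV" for "is"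
    using \<phi> by (simp add: test_functions_def)
  show "\<phi> \<in> L2 \<Omega>"
    using d[of "[]"] by (intro continuous_L2[OF \<Omega>] differentiable_imp_continuous_on) simp
  have "continuous_on UNIV (partial i \<phi>)" for i
    using d[of "[i]"] by (intro differentiable_imp_continuous_on) simp
  then show "grad \<phi> \<in> L2 \<Omega>"
    unfolding grad_def[abs_def] by (intro continuous_L2[OF \<Omega>] continuous_on_vec_lambda)
qed

lemma H_div_midpoint:
  fixes u v :: "real^'n::finite \<Rightarrow> real^'n"
  assumes \<Omega>: "open \<Omega>" "bounded \<Omega>" and u: "u \<in> H_div \<Omega>" and v: "v \<in> H_div \<Omega>"
  shows "(\<lambda>x. (1/2) *\<^sub>R (u x + v x)) \<in> H_div \<Omega>"
proof -
  obtain g where g: "u \<in> L2 \<Omega>" "g \<in> L2 \<Omega>"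
      "\<And>\<phi>. \<phi> \<in> test_functions \<Omega> \<Longrightarrow> L2_inner \<Omega> u (grad \<phi>) = - L2_inner \<Omega> g \<phi>"
    using u by (auto simp: H_div_def)
  obtain h where h: "v \<in> L2 \<Omega>" "h \<in> L2 \<Omega>"
      "\<And>\<phi>. \<phi> \<in> test_functions \<Omega> \<Longrightarrow> L2_inner \<Omega> v (grad \<phi>) = - L2_inner \<Omega> h \<phi>"
    using v by (auto simp: H_div_def)
  have "L2_inner \<Omega> (\<lambda>x. (1/2) *\<^sub>R (u x + v x)) (grad \<phi>) = - L2_inner \<Omega> (\<lambda>x. (1/2) *\<^sub>R (g x + h x)) \<phi>"
    if \<phi>: "\<phi> \<in> test_functions \<Omega>" for \<phi>
    using L2_inner_midpoint[OF g(1) h(1) test_function_L2(2)[OF \<Omega> \<phi>]]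
      L2_inner_midpoint[OF g(2) h(2) test_function_L2(1)[OF \<Omega> \<phi>]] g(3)[OF \<phi>] h(3)[OF \<phi>] by simp
  then show ?thesis
    unfolding H_div_def using L2_midpoint[OF g(1) h(1)] L2_midpoint[OF g(2) h(2)] by blast
qed

lemma polys_midpoint:
  assumes "p \<in> polys j" "q \<in> polys j"
  shows "(\<lambda>x. 1/2 * (p x + q x)) \<in> polys j"
proof -
  obtain c d where "\<And>x. p x = (\<Sum>\<alpha> | (\<Sum>i\<in>UNIV. \<alpha> i) \<le> j. c \<alpha> * (\<Prod>i\<in>UNIV. (x $ i) ^ \<alpha> i))"
      "\<And>x. q x = (\<Sum>\<alpha> | (\<Sum>i\<in>UNIV. \<alpha> i) \<le> j. d \<alpha> * (\<Prod>i\<in>UNIV. (x $ i) ^ \<alpha> i))"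
    using assms unfolding polys_def by blast
  then have "1/2 * (p x + q x) = (\<Sum>\<alpha> | (\<Sum>i\<in>UNIV. \<alpha> i) \<le> j.
      (1/2 * (c \<alpha> + d \<alpha>)) * (\<Prod>i\<in>UNIV. (x $ i) ^ \<alpha> i))" for x
    by (simp add: sum.distrib[symmetric] sum_distrib_left distrib_right add_divide_distrib)
  then show ?thesis unfolding polys_def mem_Collect_eq
    by (intro exI[of _ "\<lambda>\<alpha>. 1/2 * (c \<alpha> + d \<alpha>)"] allI)
qed

lemma vec_polys_midpoint:
  assumes "p \<in> vec_polys j" "q \<in> vec_polys j"
  shows "(\<lambda>x. (1/2) *\<^sub>R (p x + q x)) \<in> vec_polys j"
  unfolding vec_polys_def mem_Collect_eq vector_scaleR_component vector_add_component real_scaleR_def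
proof
  fix i show "(\<lambda>x. 1/2 * (p x $ i + q x $ i)) \<in> polys j"
    using assms by (intro polys_midpoint) (simp_all add: vec_polys_def)
qed

lemma RT_midpoint:
  assumes "p \<in> RT k" "q \<in> RT k"
  shows "(\<lambda>x. (1/2) *\<^sub>R (p x + q x)) \<in> RT k"
proof -
  obtain a f where p: "p = (\<lambda>x. a x + f x *\<^sub>R x)" "a \<in> vec_polys k" "f \<in> polys k"
    using assms(1) unfolding RT_def by blast
  obtain b g where q: "q = (\<lambda>x. b x + g x *\<^sub>R x)" "b \<in> vec_polys k" "g \<in> polys k"
    using assms(2) unfolding RT_def by blast
  have "(\<lambda>x. (1/2) *\<^sub>R (p x + q x))
      = (\<lambda>x. (1/2) *\<^sub>R (a x + b x) + (1/2 * (f x + g x)) *\<^sub>R x)"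
    unfolding p(1) q(1) by (rule ext) (simp add: algebra_simps add_divide_distrib)
  then show ?thesis
    unfolding RT_def mem_Collect_eq using vec_polys_midpoint[OF p(2) q(2)] polys_midpoint[OF p(3) q(3)]
    by (intro exI[of _ "\<lambda>x. (1/2) *\<^sub>R (a x + b x)"] exI[of _ "\<lambda>x. 1/2 * (f x + g x)"] conjI)
qed

lemma piecewise_midpoint:
  assumes "u \<in> piecewise M S" "v \<in> piecewise M S"
    and S: "\<And>p q. p \<in> S \<Longrightarrow> q \<in> S \<Longrightarrow> (\<lambda>x. (1/2) *\<^sub>R (p x + q x)) \<in> S"
  shows "(\<lambda>x. (1/2) *\<^sub>R (u x + v x)) \<in> piecewise M S"
  unfolding piecewise_def mem_Collect_eq
proof
  fix K assume "K \<in> cells M"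
  then obtain p q where "p \<in> S" "\<forall>x\<in>interior K. u x = p x" "q \<in> S" "\<forall>x\<in>interior K. v x = q x"
    using assms(1,2) unfolding piecewise_def by blast
  then show "\<exists>r\<in>S. \<forall>x\<in>interior K. (1/2) *\<^sub>R (u x + v x) = r x"
    using S by (intro bexI[of _ "\<lambda>x. (1/2) *\<^sub>R (p x + q x)"]) auto
qed

text \<open>
  Limits may be added only where they exist, which the continuous local representatives guarantee.
\<close>

lemma trace_midpoint:
  fixes M :: "'n::finite mesh" and u v :: "real^'n \<Rightarrow> real^'n"
  assumes M: "conforming_mesh M" and u: "u \<in> piecewise M S" and v: "v \<in> piecewise M S"
    and S: "\<And>p. p \<in> S \<Longrightarrow> C1_vec p" and K: "K \<in> cells M" "x \<in> K"
  shows "trace K (\<lambda>x. (1/2) *\<^sub>R (u x + v x)) x = (1/2) *\<^sub>R (trace K u x + trace K v x)"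
proof -
  obtain p q where p: "p \<in> S" "\<forall>x\<in>interior K. u x = p x" and q: "q \<in> S" "\<forall>x\<in>interior K. v x = q x"
    using u v K(1) unfolding piecewise_def by blast
  note c = C1_vec_continuous[OF S[OF p(1)]] C1_vec_continuous[OF S[OF q(1)]]
  note t = trace_eq[OF mesh_cell(6)[OF M K(1)] K(2)]
  have "trace K u x = p x" "trace K v x = q x" using p q by (auto intro!: t c)
  moreover have "trace K (\<lambda>x. (1/2) *\<^sub>R (u x + v x)) x = (1/2) *\<^sub>R (p x + q x)"
    by (rule t) (use p q in \<open>auto intro!: continuous_intros c\<close>)
  ultimately show ?thesis by simp
qed

lemma V_div_midpoint:
  fixes M :: "'n::finite mesh" and u v :: "real^'n \<Rightarrow> real^'n"
  assumes M: "conforming_mesh M" and u: "u \<in> V_div M S" and v: "v \<in> V_div M S"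
    and S: "\<And>p. p \<in> S \<Longrightarrow> C1_vec p"
    and mid: "\<And>p q. p \<in> S \<Longrightarrow> q \<in> S \<Longrightarrow> (\<lambda>x. (1/2) *\<^sub>R (p x + q x)) \<in> S"
  shows "(\<lambda>x. (1/2) *\<^sub>R (u x + v x)) \<in> V_div M S"
proof -
  have uv: "u \<in> H_div (region M)" "v \<in> H_div (region M)" "u \<in> piecewise M S" "v \<in> piecewise M S"
    and bd: "\<And>F x. F \<in> boundary_faces M \<Longrightarrow> x \<in> F \<Longrightarrow> trace (Kplus M F) u x \<bullet> normal M F = 0"
      "\<And>F x. F \<in> boundary_faces M \<Longrightarrow> x \<in> F \<Longrightarrow> trace (Kplus M F) v x \<bullet> normal M F = 0"
    using u v by (auto simp: V_div_def)
  have "trace (Kplus M F) (\<lambda>x. (1/2) *\<^sub>R (u x + v x)) x \<bullet> normal M F = 0"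
    if F: "F \<in> boundary_faces M" "x \<in> F" for F x
  proof -
    have "Kplus M F \<in> cells M" "x \<in> Kplus M F"
      using conforming_meshD(9)[OF M F(1)] F(2) facet_of_imp_subset by blast+
    then show ?thesis
      using trace_midpoint[OF M uv(3,4) S] bd[OF F] by (simp add: inner_add_left)
  qed
  moreover have "(\<lambda>x. (1/2) *\<^sub>R (u x + v x)) \<in> piecewise M S"
    by (rule piecewise_midpoint[OF uv(3,4) mid])
  ultimately show ?thesis
    using H_div_midpoint[OF conforming_meshD(1,2)[OF M] uv(1,2)] unfolding V_div_def by blast
qed

section \<open>Stability of the time step\<close>

text \<open>
  Since \<open>(u1 - u0) \<bullet> (u1 + u0) = \<bar>u1\<bar>\<^sup>2 - \<bar>u0\<bar>\<^sup>2\<close>, testing the difference quotient with the midpoint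
  yields the difference of the energies.
\<close>

lemma L2_norm_time_step:
  fixes u0 u1 :: "real^'n::finite \<Rightarrow> 'b::euclidean_space"
  assumes u: "u0 \<in> L2 \<Omega>" "u1 \<in> L2 \<Omega>" and \<tau>: "\<tau> > 0"
    and le: "L2_inner \<Omega> (\<lambda>x. (u1 x - u0 x) /\<^sub>R \<tau>) (\<lambda>x. (1/2) *\<^sub>R (u1 x + u0 x)) \<le> 0"
  shows "L2_norm \<Omega> u1 \<le> L2_norm \<Omega> u0"
proof -
  have eq: "((u1 x - u0 x) /\<^sub>R \<tau>) \<bullet> ((1/2) *\<^sub>R (u1 x + u0 x)) = inverse (2 * \<tau>) * (u1 x \<bullet> u1 x - u0 x \<bullet> u0 x)" for x
    by (simp add: inner_diff_left inner_add_right inner_commute[of "u0 x" "u1 x"] algebra_simps)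
  have "L2_inner \<Omega> (\<lambda>x. (u1 x - u0 x) /\<^sub>R \<tau>) (\<lambda>x. (1/2) *\<^sub>R (u1 x + u0 x))
      = inverse (2 * \<tau>) * (L2_inner \<Omega> u1 u1 - L2_inner \<Omega> u0 u0)"
    unfolding L2_inner_def eq
    using L2_inner_integrable[OF u(1,1)] L2_inner_integrable[OF u(2,2)] by simp
  moreover have "inverse (2 * \<tau>) > 0" using \<tau> by simp
  ultimately have "L2_inner \<Omega> u1 u1 - L2_inner \<Omega> u0 u0 \<le> 0"
    using le by (metis mult_pos_pos not_le)
  then show ?thesis by (simp add: L2_norm_def)
qed

theorem theorem2:
  fixes M :: "'n::finite mesh"
    and k N :: nat
    and \<sigma> \<theta> \<gamma> T :: real
    and \<zeta> :: "(real^'n) set \<Rightarrow> real"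
    and c_h :: "(real^'n \<Rightarrow> real^'n) \<Rightarrow> (real^'n \<Rightarrow> real^'n) \<Rightarrow> real"
    and X_h :: "(real^'n \<Rightarrow> real^'n) set"
    and t \<tau> :: "nat \<Rightarrow> real"
    and u u_half :: "nat \<Rightarrow> real^'n \<Rightarrow> real^'n"
    and P_half :: "nat \<Rightarrow> real^'n \<Rightarrow> real"
  assumes "CARD('n) \<in> {2, 3}"
    and "conforming_mesh M"
    and "shape_regular \<sigma> M"
    and "\<theta> \<in> {0, 1, -1}"
    and "\<gamma> > 0"
    and "\<forall>F\<in>faces M. \<zeta> F \<ge> 0"
    and "c_h \<in> {c1_form M \<zeta> \<theta>, c2_form M \<zeta> \<theta>}"
    and "(X_h = V_h M k \<and> (\<forall>F\<in>boundary_faces M. \<zeta> F \<ge> 1/2 * \<bar>1 - \<theta>\<bar>))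
         \<or> X_h \<in> {V_div M (RT k), V_div M (BDM k)}"
    and "t 0 = 0" and "\<forall>n<N. t n < t (Suc n)" and "t N = T"
    and "\<forall>n<N. \<tau> n = t (Suc n) - t n"
    and "u 0 \<in> X_h"
    and "\<forall>n<N. u (Suc n) \<in> X_h \<and> P_half n \<in> Q_h M k"
    and "\<forall>n<N. u_half n = (\<lambda>x. (1/2) *\<^sub>R (u (Suc n) x + u n x))"
    and "\<forall>n<N. \<forall>v\<in>X_h.
           L2_inner (region M) (\<lambda>x. (u (Suc n) x - u n x) /\<^sub>R \<tau> n) v
           + c_h (u_half n) v - b_form M v (P_half n) + d_form M \<gamma> (u_half n) v = 0"
    and "\<forall>n<N. \<forall>q\<in>Q_h M k. b_form M (u_half n) q = 0"
  shows "\<forall>n<N. L2_norm (region M) (u (Suc n)) \<le> L2_norm (region M) (u n)"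
proof (intro allI impI)
  fix n assume n: "n < N"
  note M = assms(2)
  define w where "w = u_half n"
  have w: "w = (\<lambda>x. (1/2) *\<^sub>R (u (Suc n) x + u n x))" using assms(15) n by (simp add: w_def)
  have un: "u n \<in> X_h" using assms(13,14) n by (cases n) auto
  have un1: "u (Suc n) \<in> X_h" and Pn: "P_half n \<in> Q_h M k" using assms(14) n by auto
  have sm: "\<And>p. p \<in> RT k \<Longrightarrow> C1_vec p" "\<And>p. p \<in> BDM k \<Longrightarrow> C1_vec p"
    by (simp_all add: RT_C1 BDM_def vec_polys_C1)
  obtain S where S: "\<And>p. p \<in> S \<Longrightarrow> C1_vec p" and wS: "w \<in> piecewise M S" and wX: "w \<in> X_h"
    and XL2: "X_h \<subseteq> L2 (region M)"
    and bd: "\<And>F. F \<in> boundary_faces M \<Longrightarrow> \<zeta> F \<ge> 1/2 * \<bar>1 - \<theta>\<bar> \<or>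
      (\<forall>x\<in>F. trace (Kplus M F) w x \<bullet> normal M F = 0)"
  (* The boundary flux is absorbed by the penalty in the first case, and vanishes in the second. *)
  proof (cases "X_h = V_h M k \<and> (\<forall>F\<in>boundary_faces M. \<zeta> F \<ge> 1/2 * \<bar>1 - \<theta>\<bar>)")
    case True
    then have X: "X_h = V_h M k" and z: "\<And>F. F \<in> boundary_faces M \<Longrightarrow> \<zeta> F \<ge> 1/2 * \<bar>1 - \<theta>\<bar>" by auto
    have uv: "u (Suc n) \<in> L2 (region M)" "u n \<in> L2 (region M)"
      "u (Suc n) \<in> piecewise M (vec_polys (k+1))" "u n \<in> piecewise M (vec_polys (k+1))"
      using un un1 unfolding X V_h_def by auto
    have wp: "w \<in> piecewise M (vec_polys (k+1))"
      unfolding w by (rule piecewise_midpoint[OF uv(3,4) vec_polys_midpoint])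
    moreover have "w \<in> X_h" unfolding X V_h_def using wp L2_midpoint[OF uv(1,2)] by (simp add: w)
    ultimately show ?thesis
      using that[of "vec_polys (k+1)"] vec_polys_C1 z by (auto simp: X V_h_def)
  next
    case False
    then have "\<exists>S\<in>{RT k, BDM k}. X_h = V_div M S" using assms(8) by blast
    then obtain S where SS: "S \<in> {RT k, BDM k}" and X: "X_h = V_div M S" by blast
    have S: "C1_vec p" if "p \<in> S" for p using SS sm that by auto
    have mid: "(\<lambda>x. (1/2) *\<^sub>R (p x + q x)) \<in> S" if "p \<in> S" "q \<in> S" for p q
      using SS RT_midpoint vec_polys_midpoint that unfolding BDM_def by blast
    have wX: "w \<in> V_div M S"
      unfolding w by (rule V_div_midpoint[OF M un1[unfolded X] un[unfolded X] S mid])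
    moreover have "V_div M S \<subseteq> L2 (region M)" by (auto simp: V_div_def H_div_def)
    ultimately show ?thesis
      using that[of S] S X by (simp add: V_div_def)
  qed
  have \<theta>: "\<theta> \<le> 1" using assms(4) by auto
  have c: "0 \<le> c_h w w"
    using convection_nonneg[OF M wS S \<theta> _ bd] assms(6,7) by auto
  have "L2_inner (region M) (\<lambda>x. (u (Suc n) x - u n x) /\<^sub>R \<tau> n) w
      + c_h w w - b_form M w (P_half n) + d_form M \<gamma> w w = 0"
    using assms(16) n wX by (simp add: w_def)
  moreover have "b_form M w (P_half n) = 0" using assms(17) n Pn by (simp add: w_def)
  moreover have "0 \<le> d_form M \<gamma> w w" by (rule d_form_nonneg[OF M assms(5)])
  ultimately have "L2_inner (region M) (\<lambda>x. (u (Suc n) x - u n x) /\<^sub>R \<tau> n) w \<le> 0"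
    using c by linarith
  then show "L2_norm (region M) (u (Suc n)) \<le> L2_norm (region M) (u n)"
    using L2_norm_time_step[of "u n" "region M" "u (Suc n)" "\<tau> n"] XL2 un un1 assms(10,12) n
    unfolding w by auto
qed

end
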